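(* Let $A(x)$, $x\in D_0$, be a holomorphic family of bounded operators on a separable (infinite-dimensional) Hilbert space $\mathbb{H}$ with orthonormal basis $\{e_1,e_2,\ldots\}$, with domain $D_0$ in the complex plane, $0\in D_0$, such that $A(x)$ is self-adjoint for each $x\in D_0$, and let $A=A(0)$. Let $\lambda_{n1}\ge\lambda_{n2}\ge\cdots\ge\lambda_{nn}$ be the eigenvalues of the truncation $A_n$ arranged in decreasing order. For each positive integer $n$, let $\{w_{nk}: k=1,2,\ldots,n\}$ be a set of numbers such that $0\le w_{nk}\le 1$ and $\sum_{k=1}^n w_{nk}=1$, and suppose there exist $\delta>0$ and $K>0$ such that, for every $n$, $$\#\left\{\lambda_{nj} : \left|\sum_{k=1}^n w_{nk}\lambda_{nk}-\lambda_{nj}\right|<\delta\right\}<K.$$ In addition, assume that $\sigma_e(A)$ and $\sigma(A)$ coincide. Then $\sigma_e(A(x))$ has a gap for each $x$ in a sufficiently small neighborhood of $0$.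
   Context: A family of bounded operators $A(x)$, $x\in D_0\subseteq\mathbb{C}$, is called holomorphic if for each $y\in D_0$ the limit $\lim_{x\to y}\frac{\|A(x)-A(y)\|}{|x-y|}$ exists and is finite. $P_n$ is the orthogonal projection of $\mathbb{H}$ onto the span of $\{e_1,\ldots,e_n\}$, and $A_n=P_nAP_n$, regarded as an operator (an $n\times n$ matrix) on that span. $\sigma$ and $\sigma_e$ denote the spectrum and the essential spectrum. Eigenvalues are counted with multiplicity, and $\#$ denotes the number of elements (here: the number of indices $j\in\{1,\dots,n\}$ satisfying the inequality). A gap in $\sigma_e(T)$, for $T$ bounded self-adjoint, is a nonempty open interval lying between the lower and upper bounds (infimum and supremum) of $\sigma_e(T)$ and containing no point of $\sigma_e(T)$. *)

theory Defs
  imports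
    "HOL-Analysis.Analysis"
    "Jordan_Normal_Form.Char_Poly"
begin

text \<open>Complex Hilbert spaces. The inner product is conjugate-linear in its first argument.
  The class extends the real Banach spaces, so the operator norm is the library's
  \<^const>\<open>onorm\<close> and boundedness is the library's \<^const>\<open>bounded_linear\<close>.\<close>

class complex_hilbert_space = banach +
  fixes scaleC :: "complex \<Rightarrow> 'a \<Rightarrow> 'a"  (infixr "*\<^sub>C" 75)
    and cinner :: "'a \<Rightarrow> 'a \<Rightarrow> complex"
  assumes scaleC_add_right: "c *\<^sub>C (x + y) = c *\<^sub>C x + c *\<^sub>C y"
    and scaleC_add_left: "(c + d) *\<^sub>C x = c *\<^sub>C x + d *\<^sub>C x"
    and scaleC_scaleC: "c *\<^sub>C (d *\<^sub>C x) = (c * d) *\<^sub>C x"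
    and scaleC_of_real: "complex_of_real r *\<^sub>C x = r *\<^sub>R x"
    and cinner_commute: "cinner x y = cnj (cinner y x)"
    and cinner_add_right: "cinner x (y + z) = cinner x y + cinner x z"
    and cinner_scaleC_right: "cinner x (c *\<^sub>C y) = c * cinner x y"
    and cinner_self: "cinner x x = complex_of_real ((norm x)\<^sup>2)"

lemma vector_space_scaleC:
  "vector_space (scaleC :: complex \<Rightarrow> 'a::complex_hilbert_space \<Rightarrow> 'a)"
proof
  fix x :: 'a
  show "1 *\<^sub>C x = x"
    using scaleC_of_real[of 1 x] by simp
qed (simp_all add: scaleC_add_right scaleC_add_left scaleC_scaleC)

instantiation complex :: complex_hilbert_space
begin

definition scaleC_complex :: "complex \<Rightarrow> complex \<Rightarrow> complex"
  where "scaleC_complex c x = c * x"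

definition cinner_complex :: "complex \<Rightarrow> complex \<Rightarrow> complex"
  where "cinner_complex x y = cnj x * y"

instance
proof
  fix x :: complex
  show "cinner x x = complex_of_real ((norm x)\<^sup>2)"
    unfolding cinner_complex_def by (metis complex_norm_square mult.commute)
qed (simp_all add: scaleC_complex_def cinner_complex_def algebra_simps scaleR_conv_of_real)

end

definition orthonormal_basis :: "(nat \<Rightarrow> 'a::complex_hilbert_space) \<Rightarrow> bool" where
  "orthonormal_basis e \<longleftrightarrow>
     (\<forall>i j. cinner (e i) (e j) = (if i = j then 1 else 0)) \<and>
     closure (module.span scaleC (range e)) = UNIV"

definition bounded_operator :: "('a::complex_hilbert_space \<Rightarrow> 'a) \<Rightarrow> bool" where
  "bounded_operator T \<longleftrightarrow> bounded_linear T \<and> (\<forall>c v. T (c *\<^sub>C v) = c *\<^sub>C T v)"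

definition selfadjoint_operator :: "('a::complex_hilbert_space \<Rightarrow> 'a) \<Rightarrow> bool" where
  "selfadjoint_operator T \<longleftrightarrow>
     bounded_operator T \<and> (\<forall>u v. cinner (T u) v = cinner u (T v))"

definition compact_operator :: "('a::complex_hilbert_space \<Rightarrow> 'a) \<Rightarrow> bool" where
  "compact_operator T \<longleftrightarrow> bounded_operator T \<and> compact (closure (T ` cball 0 1))"

definition op_spectrum :: "('a::complex_hilbert_space \<Rightarrow> 'a) \<Rightarrow> complex set" where
  "op_spectrum T = {z. \<not> (\<exists>S. bounded_operator S \<and>
     (\<forall>v. S (T v - z *\<^sub>C v) = v) \<and> (\<forall>v. T (S v) - z *\<^sub>C S v = v))}"

text \<open>The essential spectrum is the spectrum of the coset of the operator in the Calkin algebra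
  (bounded operators modulo compact ones); being invertible there means being invertible up to
  compact operators. By Atkinson's theorem this is failure of the Fredholm property.\<close>

definition essential_spectrum :: "('a::complex_hilbert_space \<Rightarrow> 'a) \<Rightarrow> complex set" where
  "essential_spectrum T = {z. \<not> (\<exists>S. bounded_operator S \<and>
     compact_operator (\<lambda>v. S (T v - z *\<^sub>C v) - v) \<and>
     compact_operator (\<lambda>v. T (S v) - z *\<^sub>C S v - v))}"

text \<open>Meant for nonempty bounded sets of real numbers, such as the essential spectrum of a
  bounded self-adjoint operator on an infinite-dimensional space.\<close>

definition has_gap :: "complex set \<Rightarrow> bool" where
  "has_gap S \<longleftrightarrow> (\<exists>a b::real. a < b \<and> Inf (Re ` S) \<le> a \<and> b \<le> Sup (Re ` S) \<and>
     (\<forall>t\<in>{a<..<b}. complex_of_real t \<notin> S))"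

text \<open>The limit is that of the quotient of norms, not of a difference quotient in operator norm.\<close>

definition holomorphic_family ::
  "complex set \<Rightarrow> (complex \<Rightarrow> 'a::complex_hilbert_space \<Rightarrow> 'a) \<Rightarrow> bool" where
  "holomorphic_family D A \<longleftrightarrow>
     (\<forall>x\<in>D. bounded_operator (A x)) \<and>
     (\<forall>y\<in>D. \<exists>L::real.
        ((\<lambda>x. onorm (\<lambda>v. A x v - A y v) / cmod (x - y)) \<longlongrightarrow> L) (at y within D))"

definition basis_projection :: "(nat \<Rightarrow> 'a::complex_hilbert_space) \<Rightarrow> nat \<Rightarrow> 'a \<Rightarrow> 'a" where
  "basis_projection e n v = (\<Sum>k<n. cinner (e k) v *\<^sub>C e k)"

definition truncation_matrix ::
  "(nat \<Rightarrow> 'a::complex_hilbert_space) \<Rightarrow> ('a \<Rightarrow> 'a) \<Rightarrow> nat \<Rightarrow> complex mat" where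
  "truncation_matrix e T n = mat n n (\<lambda>(i, j).
     cinner (e i) (basis_projection e n (T (basis_projection e n (e j)))))"

text \<open>Multiplicities are those of the roots of the characteristic polynomial; for the Hermitian
  matrices of interest they are also the dimensions of the eigenspaces.\<close>

definition decreasing_eigenvalues :: "complex mat \<Rightarrow> nat \<Rightarrow> (nat \<Rightarrow> real) \<Rightarrow> bool" where
  "decreasing_eigenvalues M n l \<longleftrightarrow>
     char_poly M = (\<Prod>k<n. [:- complex_of_real (l k), 1:]) \<and>
     (\<forall>j k. j \<le> k \<longrightarrow> k < n \<longrightarrow> l k \<le> l j)"

end

theory Submission
  imports Defs "Jordan_Normal_Form.Schur_Decomposition"
begin

text \<open>
  Let \<open>T = A 0\<close>, and let \<open>c\<close> be a limit point of the weighted means of the eigenvalues of the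
  truncations. Near a point of the essential spectrum of \<open>T\<close> the number of eigenvalues of the
  truncations grows without bound (\<open>essentially_singular_crowding\<close>), whereas near \<open>c\<close> there are
  fewer than \<open>K\<close> of them for infinitely many truncations. So an interval around \<open>c\<close> misses the
  essential spectrum. The means lie between the minimum and the maximum of the eigenvalues, which are
  values of the numerical range, and the numerical range lies between the minimum and the maximum of
  the spectrum. As the spectrum equals the essential spectrum, the latter has points on both sides of
  \<open>c\<close>, and the interval is a gap.

  For the perturbation everything is expressed by a quantitative form of Weyl's criterion,
  \<open>essentially_singular T z \<epsilon>\<close>: outside any finite set of directions there are unit vectors that
  \<open>T - z\<close> shrinks below \<open>\<epsilon>\<close>. If this holds for all \<open>\<epsilon>\<close>, then \<open>z\<close> is in the essential spectrum, and
  conversely (\<open>in_essential_spectrum\<close>, \<open>not_in_essential_spectrum\<close>). The crowding argument excludes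
  it for one \<open>\<epsilon>\<close> and all \<open>t\<close> near \<open>c\<close>, and this survives a change of \<open>T\<close> by less than \<open>\<epsilon>\<close> in norm.
  The points on the two sides of \<open>c\<close> remain essentially singular up to a small \<open>\<epsilon>\<close>; since the infimum
  of the essential numerical range belongs to the essential spectrum
  (\<open>bottom_is_approximate_eigenvalue\<close>), the perturbed essential spectrum still has points below the
  interval and, applying this to \<open>- T\<close>, above it.
\<close>

section \<open>Inner product and bounded operators\<close>

lemma cinner_add_left: "cinner (x + y) z = cinner x z + cinner y z"
  by (metis cinner_add_right cinner_commute complex_cnj_add)

lemma cinner_scaleC_left: "cinner (c *\<^sub>C x) y = cnj c * cinner x y"
  by (metis cinner_commute cinner_scaleC_right complex_cnj_mult)

lemma cinner_scaleR_right: "cinner x (r *\<^sub>R y) = of_real r * cinner x y"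
  by (metis cinner_scaleC_right scaleC_of_real)

lemma cinner_scaleR_left: "cinner (r *\<^sub>R x) y = of_real r * cinner x y"
  by (metis cinner_scaleC_left complex_cnj_complex_of_real scaleC_of_real)

lemma cinner_zero_right [simp]: "cinner x 0 = 0"
  using cinner_add_right[of x 0 0] by simp

lemma cinner_zero_left [simp]: "cinner 0 x = 0"
  using cinner_add_left[of 0 0 x] by simp

lemma cinner_minus_right: "cinner x (- y) = - cinner x y"
  using cinner_add_right[of x y "- y"] by (simp add: add_eq_0_iff)

lemma cinner_minus_left: "cinner (- x) y = - cinner x y"
  using cinner_add_left[of x "- x" y] by (simp add: add_eq_0_iff)

lemma cinner_diff_right: "cinner x (y - z) = cinner x y - cinner x z"
  using cinner_add_right[of x y "- z"] by (simp add: cinner_minus_right)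

lemma cinner_diff_left: "cinner (x - y) z = cinner x z - cinner y z"
  using cinner_add_left[of x "- y" z] by (simp add: cinner_minus_left)

lemma cinner_sum_right: "cinner x (\<Sum>i\<in>I. f i) = (\<Sum>i\<in>I. cinner x (f i))"
  by (induction I rule: infinite_finite_induct) (simp_all add: cinner_add_right)

lemma cinner_sum_left: "cinner (\<Sum>i\<in>I. f i) x = (\<Sum>i\<in>I. cinner (f i) x)"
  by (induction I rule: infinite_finite_induct) (simp_all add: cinner_add_left)

lemma scaleC_zero_left [simp]: "0 *\<^sub>C x = (0::'a::complex_hilbert_space)"
  using scaleC_add_left[of 0 0 x] by simp

lemma scaleC_zero_right [simp]: "c *\<^sub>C 0 = (0::'a::complex_hilbert_space)"
  using scaleC_add_right[of c 0 "0::'a"] by simp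

lemma scaleC_one [simp]: "1 *\<^sub>C x = (x::'a::complex_hilbert_space)"
  using scaleC_of_real[of 1 x] by simp

lemma scaleC_minus_right: "c *\<^sub>C (- x) = - (c *\<^sub>C (x::'a::complex_hilbert_space))"
  using scaleC_add_right[of c x "- x"] by (simp add: add_eq_0_iff)

lemma scaleC_minus_left: "(- c) *\<^sub>C x = - (c *\<^sub>C (x::'a::complex_hilbert_space))"
  using scaleC_add_left[of c "- c" x] by (simp add: add_eq_0_iff)

lemma scaleC_diff_right: "c *\<^sub>C (x - y) = c *\<^sub>C x - c *\<^sub>C (y::'a::complex_hilbert_space)"
  using scaleC_add_right[of c x "- y"] by (simp add: scaleC_minus_right)

lemma Re_cinner_self: "Re (cinner v v) = (norm v)\<^sup>2"
  by (simp add: cinner_self)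

lemma norm_scaleC: "norm (c *\<^sub>C x) = cmod c * norm (x::'a::complex_hilbert_space)"
proof -
  have "complex_of_real ((norm (c *\<^sub>C x))\<^sup>2) = cnj c * c * cinner x x"
    unfolding cinner_self[symmetric] by (simp add: cinner_scaleC_left cinner_scaleC_right)
  also have "\<dots> = complex_of_real ((cmod c * norm x)\<^sup>2)"
    by (simp add: cinner_self power_mult_distrib complex_norm_square mult.commute flip: of_real_power)
  finally have "(norm (c *\<^sub>C x))\<^sup>2 = (cmod c * norm x)\<^sup>2"
    using of_real_eq_iff by blast
  then show ?thesis
    by (simp add: power2_eq_iff_nonneg)
qed

lemma cinner_swap_self: "cinner x y * cinner y x = complex_of_real ((cmod (cinner x y))\<^sup>2)"
  by (metis cinner_commute complex_norm_square)

lemma cauchy_schwarz: "cmod (cinner x y) \<le> norm x * norm y"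
proof (cases "x = 0")
  case False
  define c where "c = cinner x y / cinner x x"
  have x: "cinner x x \<noteq> 0"
    using False by (simp add: cinner_self)
  have "cinner x (y - c *\<^sub>C x) = 0"
    using x by (simp add: cinner_diff_right cinner_scaleC_right c_def)
  then have "cinner (y - c *\<^sub>C x) (y - c *\<^sub>C x) = cinner y y - c * cinner y x"
    by (simp add: cinner_diff_right cinner_scaleC_right cinner_diff_left cinner_scaleC_left algebra_simps)
  also have "c * cinner y x = (cmod (cinner x y))\<^sup>2 / (norm x)\<^sup>2"
    by (simp add: c_def cinner_swap_self cinner_self[of x])
  finally have "(norm (y - c *\<^sub>C x))\<^sup>2 = (norm y)\<^sup>2 - (cmod (cinner x y))\<^sup>2 / (norm x)\<^sup>2"
    unfolding cinner_self of_real_power[symmetric] of_real_divide[symmetric] of_real_diff[symmetric]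
      of_real_eq_iff .
  then have "(cmod (cinner x y))\<^sup>2 / (norm x)\<^sup>2 \<le> (norm y)\<^sup>2"
    by (metis diff_ge_0_iff_ge zero_le_power2)
  then have "(cmod (cinner x y))\<^sup>2 \<le> (norm x * norm y)\<^sup>2"
    using False by (simp add: divide_simps power_mult_distrib mult.commute)
  then show ?thesis
    by (rule power2_le_imp_le) simp
qed simp

lemma norm_diff_sq:
  "(norm (x - y))\<^sup>2 = (norm x)\<^sup>2 - 2 * Re (cinner x y) + (norm y)\<^sup>2"
proof -
  have "Re (cinner y x) = Re (cinner x y)"
    by (subst cinner_commute) simp
  then show ?thesis
    unfolding Re_cinner_self[symmetric] by (simp add: cinner_diff_left cinner_diff_right)
qed

lemma bounded_operatorI:
  assumes "\<And>x y. T (x + y) = T x + T y" "\<And>c x. T (c *\<^sub>C x) = c *\<^sub>C T x"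
    and "\<And>x. norm (T x) \<le> norm x * B"
  shows "bounded_operator T"
  unfolding bounded_operator_def
proof (intro conjI allI)
  show "bounded_linear T"
  proof (rule bounded_linear_intro)
    show "T (r *\<^sub>R x) = r *\<^sub>R T x" for r x
      using assms(2)[of "of_real r" x] by (simp add: scaleC_of_real)
  qed (use assms in auto)
qed (rule assms)

lemma bounded_operator_linear: "bounded_operator T \<Longrightarrow> bounded_linear T"
  by (simp add: bounded_operator_def)

lemma bounded_operator_scaleC: "bounded_operator T \<Longrightarrow> T (c *\<^sub>C v) = c *\<^sub>C T v"
  by (simp add: bounded_operator_def)

lemma bounded_operator_add:
  "bounded_operator S \<Longrightarrow> bounded_operator T \<Longrightarrow> bounded_operator (\<lambda>v. S v + T v)"
  by (simp add: bounded_operator_def bounded_linear_add scaleC_add_right)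

lemma bounded_operator_diff:
  "bounded_operator S \<Longrightarrow> bounded_operator T \<Longrightarrow> bounded_operator (\<lambda>v. S v - T v)"
  by (simp add: bounded_operator_def bounded_linear_sub scaleC_diff_right)

lemma bounded_operator_compose:
  "bounded_operator S \<Longrightarrow> bounded_operator T \<Longrightarrow> bounded_operator (\<lambda>v. S (T v))"
  by (simp add: bounded_operator_def bounded_linear_compose)

lemma bounded_operator_zero: "bounded_operator (\<lambda>v. 0)"
  by (simp add: bounded_operator_def bounded_linear_zero)

lemma bounded_operator_const_scaleC: "bounded_operator (\<lambda>v. c *\<^sub>C v)"
  by (rule bounded_operatorI[where B="cmod c"])
    (simp_all add: scaleC_add_right scaleC_scaleC norm_scaleC mult.commute)

lemma bounded_operator_uminus: "bounded_operator T \<Longrightarrow> bounded_operator (\<lambda>v. - T v)"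
  using bounded_operator_diff[OF bounded_operator_zero] by simp

lemma bounded_operator_shift:
  "bounded_operator T \<Longrightarrow> bounded_operator (\<lambda>v. T v - z *\<^sub>C v)"
  by (intro bounded_operator_diff bounded_operator_const_scaleC)

lemma bounded_operator_rank_one: "bounded_operator (\<lambda>v. cinner h v *\<^sub>C k)"
proof (rule bounded_operatorI[where B="norm h * norm k"])
  fix v
  show "norm (cinner h v *\<^sub>C k) \<le> norm v * (norm h * norm k)"
    using mult_right_mono[OF cauchy_schwarz[of h v] norm_ge_zero[of k]]
    by (simp add: norm_scaleC mult.assoc mult.left_commute)
qed (simp_all add: cinner_add_right cinner_scaleC_right scaleC_add_left scaleC_scaleC)

lemma bounded_operator_sum:
  "(\<And>i. i \<in> I \<Longrightarrow> bounded_operator (f i)) \<Longrightarrow> bounded_operator (\<lambda>v. \<Sum>i\<in>I. f i v)"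
  by (induction I rule: infinite_finite_induct)
    (simp_all add: bounded_operator_zero bounded_operator_add)

lemma bounded_operator_bound:
  assumes "bounded_operator T"
  obtains M where "0 < M" "\<And>v. norm (T v) \<le> M * norm v"
  using bounded_linear.pos_bounded[OF bounded_operator_linear[OF assms]]
  by (metis mult.commute)

lemma bounded_operator_simps:
  assumes "bounded_operator T"
  shows "T (x + y) = T x + T y" "T (x - y) = T x - T y" "T (- x) = - T x" "T 0 = 0"
    "T (r *\<^sub>R x) = r *\<^sub>R T x" "T (c *\<^sub>C x) = c *\<^sub>C T x" "T (\<Sum>i\<in>I. f i) = (\<Sum>i\<in>I. T (f i))"
  using assms bounded_operator_linear[OF assms, THEN bounded_linear.linear]
  by (simp_all add: linear_add linear_diff linear_neg linear_0 linear_scale linear_sum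
      bounded_operator_scaleC)

lemma selfadjoint_bounded: "selfadjoint_operator T \<Longrightarrow> bounded_operator T"
  by (simp add: selfadjoint_operator_def)

lemma selfadjoint_cinner: "selfadjoint_operator T \<Longrightarrow> cinner (T u) v = cinner u (T v)"
  by (simp add: selfadjoint_operator_def)

lemma quadratic_bound_from_unit_vectors:
  fixes f :: "'a::real_normed_vector \<Rightarrow> real"
  assumes unit: "\<And>u. norm u = 1 \<Longrightarrow> \<kappa> \<le> f u"
    and quadratic: "\<And>r u. f (r *\<^sub>R u) = r\<^sup>2 * f u"
  shows "\<kappa> * (norm v)\<^sup>2 \<le> f v"
proof (cases "v = 0")
  case True
  then show ?thesis
    using quadratic[of 0 v] by simp
next
  case False
  have "f v = (norm v)\<^sup>2 * f ((1 / norm v) *\<^sub>R v)"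
    using False by (simp add: quadratic[symmetric])
  then show ?thesis
    using False mult_left_mono[OF unit[of "(1 / norm v) *\<^sub>R v"], of "(norm v)\<^sup>2"]
    by (simp add: mult.commute)
qed

section \<open>Invertibility of coercive operators\<close>

text \<open>A solution of \<open>P v = y\<close> is a fixed point of \<open>v \<mapsto> v - \<tau> (P v - y)\<close>. Expanding the
  square of the norm and using coercivity shows that this map is a contraction for small
  \<open>\<tau> > 0\<close>.\<close>

lemma coercive_invertible:
  fixes P :: "'a::complex_hilbert_space \<Rightarrow> 'a"
  assumes P: "bounded_operator P" and \<kappa>: "0 < \<kappa>"
    and coercive: "\<And>v. \<kappa> * (norm v)\<^sup>2 \<le> Re (cinner v (P v))"
  obtains G where "bounded_operator G" "\<And>v. G (P v) = v" "\<And>v. P (G v) = v"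
proof -
  note P_simps = bounded_operator_simps[OF P]
  obtain M0 where M0: "0 < M0" "\<And>v. norm (P v) \<le> M0 * norm v"
    using bounded_operator_bound[OF P] by blast
  \<comment> \<open>Taking \<open>M \<ge> \<kappa>\<close> keeps \<open>1 - \<kappa>\<^sup>2 / M\<^sup>2\<close> nonnegative even on the zero space.\<close>
  define M where "M = max M0 \<kappa>"
  have M: "0 < M" "\<kappa> \<le> M" "norm (P v) \<le> M * norm v" for v
    using M0 mult_right_mono[of M0 M "norm v"] by (auto simp: M_def intro: order_trans)
  \<comment> \<open>This value minimises the bound \<open>1 - 2 \<tau> \<kappa> + \<tau>\<^sup>2 M\<^sup>2\<close> for the squared contraction factor.\<close>
  define \<tau> where "\<tau> = \<kappa> / M\<^sup>2"
  define q where "q = sqrt (1 - \<kappa>\<^sup>2 / M\<^sup>2)"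
  have ratio: "\<kappa>\<^sup>2 / M\<^sup>2 \<le> 1" "0 < \<kappa>\<^sup>2 / M\<^sup>2"
    using M \<kappa> by (simp_all add: power_mono)
  then have q: "0 \<le> q" "q < 1" "q\<^sup>2 = 1 - \<kappa>\<^sup>2 / M\<^sup>2"
    by (simp_all add: q_def)
  have contraction: "norm (u - \<tau> *\<^sub>R P u) \<le> q * norm u" for u
  proof -
    have "(norm (P u))\<^sup>2 \<le> (M * norm u)\<^sup>2"
      using M(3) by (intro power_mono) auto
    then have "\<tau>\<^sup>2 * (norm (P u))\<^sup>2 \<le> \<tau>\<^sup>2 * (M * norm u)\<^sup>2"
      by (intro mult_left_mono) auto
    also have "\<dots> = \<kappa>\<^sup>2 / M\<^sup>2 * (norm u)\<^sup>2"
      using M(1) by (simp add: \<tau>_def power2_eq_square)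
    finally have upper: "\<tau>\<^sup>2 * (norm (P u))\<^sup>2 \<le> \<kappa>\<^sup>2 / M\<^sup>2 * (norm u)\<^sup>2" .
    have "\<tau> * (\<kappa> * (norm u)\<^sup>2) \<le> \<tau> * Re (cinner u (P u))"
      using coercive \<kappa> by (intro mult_left_mono) (auto simp: \<tau>_def)
    then have lower: "\<kappa>\<^sup>2 / M\<^sup>2 * (norm u)\<^sup>2 \<le> \<tau> * Re (cinner u (P u))"
      by (simp add: \<tau>_def power2_eq_square)
    have "(norm (u - \<tau> *\<^sub>R P u))\<^sup>2
        = (norm u)\<^sup>2 - 2 * (\<tau> * Re (cinner u (P u))) + \<tau>\<^sup>2 * (norm (P u))\<^sup>2"
      by (simp add: norm_diff_sq cinner_scaleR_right power_mult_distrib)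
    also have "\<dots> \<le> (norm u)\<^sup>2 - \<kappa>\<^sup>2 / M\<^sup>2 * (norm u)\<^sup>2"
      using upper lower by linarith
    also have "\<dots> = (q * norm u)\<^sup>2"
      by (simp only: power_mult_distrib q(3) left_diff_distrib mult_1)
    finally show ?thesis
      using q(1) by (rule power2_le_imp_le[OF _ mult_nonneg_nonneg[OF _ norm_ge_zero]])
  qed
  have \<tau>_pos: "0 < \<tau>"
    using M \<kappa> by (simp add: \<tau>_def)
  have surj: "\<exists>v. P v = y" for y
  proof -
    define f where "f v = v - \<tau> *\<^sub>R (P v - y)" for v
    have "dist (f u) (f v) \<le> q * dist u v" for u v
    proof -
      have "f u - f v = (u - v) - \<tau> *\<^sub>R P (u - v)"
        by (simp add: f_def P_simps algebra_simps)
      then show ?thesis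
        using contraction[of "u - v"] by (simp add: dist_norm)
    qed
    then have "\<exists>!v. f v = v"
      using q by (intro banach_fix_type) auto
    then obtain v where "f v = v"
      by blast
    then show ?thesis
      using \<tau>_pos by (auto simp: f_def)
  qed
  have below: "\<kappa> * norm v \<le> norm (P v)" for v
  proof (cases "v = 0")
    case False
    have "\<kappa> * (norm v)\<^sup>2 \<le> norm v * norm (P v)"
      using coercive[of v] complex_Re_le_cmod[of "cinner v (P v)"] cauchy_schwarz[of v "P v"]
      by linarith
    then have "norm v * (\<kappa> * norm v) \<le> norm v * norm (P v)"
      by (simp add: power2_eq_square mult_ac)
    with False show ?thesis
      by simp
  qed (simp add: P_simps)
  have inj: "P u = P v \<Longrightarrow> u = v" for u v
  proof -
    assume "P u = P v"
    then have "\<kappa> * norm (u - v) \<le> 0"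
      using below[of "u - v"] by (simp add: P_simps)
    with \<kappa> show "u = v"
      by (simp add: mult_le_0_iff)
  qed
  define G where "G y = (SOME v. P v = y)" for y
  have PG: "P (G y) = y" for y
    unfolding G_def using surj by (rule someI_ex)
  show ?thesis
  proof
    show "bounded_operator G"
    proof (rule bounded_operatorI[where B="1 / \<kappa>"])
      show "norm (G y) \<le> norm y * (1 / \<kappa>)" for y
        using below[of "G y"] \<kappa> by (simp add: PG field_simps)
      show "G (x + y) = G x + G y" for x y
        by (rule inj) (simp add: PG P_simps)
      show "G (c *\<^sub>C x) = c *\<^sub>C G x" for c x
        by (rule inj) (simp add: PG P_simps)
    qed
    show "G (P v) = v" for v
      by (rule inj) (simp add: PG)
  qed (rule PG)
qed

section \<open>Compact operators\<close>

lemma compact_operatorI: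
  assumes "bounded_operator T" "T ` cball 0 1 \<subseteq> S" "compact S"
  shows "compact_operator T"
proof -
  have "closure (T ` cball 0 1) = S \<inter> closure (T ` cball 0 1)"
    using closure_minimal[OF assms(2) compact_imp_closed[OF assms(3)]] by blast
  then have "compact (closure (T ` cball 0 1))"
    using compact_Int_closed[OF assms(3) closed_closure] by metis
  with assms(1) show ?thesis
    by (simp add: compact_operator_def)
qed

lemma compact_operator_bounded: "compact_operator T \<Longrightarrow> bounded_operator T"
  by (simp add: compact_operator_def)

lemma compact_operator_image:
  assumes "compact_operator T" "norm v \<le> 1"
  shows "T v \<in> closure (T ` cball 0 1)"
  using assms(2) by (intro subsetD[OF closure_subset] imageI) simp

lemma compact_operator_diff:
  assumes "compact_operator S" "compact_operator T"
  shows "compact_operator (\<lambda>v. S v - T v)"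
proof (rule compact_operatorI)
  show "bounded_operator (\<lambda>v. S v - T v)"
    using assms by (intro bounded_operator_diff compact_operator_bounded)
  show "compact {x - y |x y. x \<in> closure (S ` cball 0 1) \<and> y \<in> closure (T ` cball 0 1)}"
    using assms by (intro compact_differences) (auto simp: compact_operator_def)
  show "(\<lambda>v. S v - T v) ` cball 0 1
      \<subseteq> {x - y |x y. x \<in> closure (S ` cball 0 1) \<and> y \<in> closure (T ` cball 0 1)}"
  proof (rule image_subsetI)
    fix v :: 'a
    assume "v \<in> cball 0 1"
    then have "norm v \<le> 1"
      by simp
    from assms[THEN compact_operator_image, OF this]
    show "S v - T v \<in> {x - y |x y. x \<in> closure (S ` cball 0 1) \<and> y \<in> closure (T ` cball 0 1)}"
      by blast
  qed
qed

lemma compact_operator_zero: "compact_operator (\<lambda>v. 0)"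
  by (rule compact_operatorI[where S="{0}"]) (auto simp: bounded_operator_zero)

lemma compact_operator_uminus: "compact_operator T \<Longrightarrow> compact_operator (\<lambda>v. - T v)"
  using compact_operator_diff[OF compact_operator_zero] by simp

lemma compact_operator_sum:
  "(\<And>i. i \<in> I \<Longrightarrow> compact_operator (f i)) \<Longrightarrow> compact_operator (\<lambda>v. \<Sum>i\<in>I. f i v)"
proof (induction I rule: infinite_finite_induct)
  case (insert i I)
  have "compact_operator (\<lambda>v. f i v - - (\<Sum>j\<in>I. f j v))"
    using insert by (intro compact_operator_diff compact_operator_uminus) auto
  with insert show ?case
    by simp
qed (simp_all add: compact_operator_zero)

lemma compact_operator_compose_left:
  assumes "bounded_operator S" "compact_operator T"
  shows "compact_operator (\<lambda>v. S (T v))"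
proof (rule compact_operatorI)
  show "bounded_operator (\<lambda>v. S (T v))"
    by (rule bounded_operator_compose[OF assms(1) compact_operator_bounded[OF assms(2)]])
  show "compact (S ` closure (T ` cball 0 1))"
    using assms by (intro compact_continuous_image linear_continuous_on bounded_operator_linear)
      (auto simp: compact_operator_def)
  show "(\<lambda>v. S (T v)) ` cball 0 1 \<subseteq> S ` closure (T ` cball 0 1)"
    using compact_operator_image[OF assms(2)] by (intro image_subsetI imageI) simp
qed

lemma compact_operator_compose_right:
  assumes "compact_operator S" "bounded_operator T"
  shows "compact_operator (\<lambda>v. S (T v))"
proof -
  obtain M where M: "0 < M" "\<And>v. norm (T v) \<le> M * norm v"
    using bounded_operator_bound[OF assms(2)] by blast
  show ?thesis
  proof (rule compact_operatorI)
    show "bounded_operator (\<lambda>v. S (T v))"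
      by (rule bounded_operator_compose[OF compact_operator_bounded[OF assms(1)] assms(2)])
    show "compact ((\<lambda>x. M *\<^sub>R x) ` closure (S ` cball 0 1))"
      using assms by (intro compact_scaling) (auto simp: compact_operator_def)
    show "(\<lambda>v. S (T v)) ` cball 0 1 \<subseteq> (\<lambda>x. M *\<^sub>R x) ` closure (S ` cball 0 1)"
    proof (rule image_subsetI)
      fix v :: 'a
      assume "v \<in> cball 0 1"
      then have "norm (T v) \<le> M"
        using order_trans[OF M(2)[of v] mult_left_le[of "norm v" M]] M(1) by simp
      then have "norm ((1 / M) *\<^sub>R T v) \<le> 1"
        using M(1) by simp
      from compact_operator_image[OF assms(1) this]
      have "S ((1 / M) *\<^sub>R T v) \<in> closure (S ` cball 0 1)" .
      moreover have "S (T v) = M *\<^sub>R S ((1 / M) *\<^sub>R T v)"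
        using M(1) by (simp add: bounded_operator_simps(5)[OF compact_operator_bounded[OF assms(1)]])
      ultimately show "S (T v) \<in> (\<lambda>x. M *\<^sub>R x) ` closure (S ` cball 0 1)"
        by blast
    qed
  qed
qed

lemma compact_operator_rank_one: "compact_operator (\<lambda>v. cinner h v *\<^sub>C k)"
proof (rule compact_operatorI[OF bounded_operator_rank_one])
  have "bounded_linear (\<lambda>c. c *\<^sub>C k)"
    by (rule bounded_linear_intro[where K="norm k"])
      (simp_all add: scaleC_add_left norm_scaleC scaleR_conv_of_real scaleC_of_real flip: scaleC_scaleC)
  then show "compact ((\<lambda>c. c *\<^sub>C k) ` cball 0 (norm h))"
    by (intro compact_continuous_image linear_continuous_on compact_cball)
  show "(\<lambda>v. cinner h v *\<^sub>C k) ` cball 0 1 \<subseteq> (\<lambda>c. c *\<^sub>C k) ` cball 0 (norm h)"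
  proof (rule image_subsetI)
    fix v :: 'a
    assume "v \<in> cball 0 1"
    then have "cinner h v \<in> cball 0 (norm h)"
      using cauchy_schwarz[of h v] mult_left_mono[of "norm v" 1 "norm h"] by simp
    then show "cinner h v *\<^sub>C k \<in> (\<lambda>c. c *\<^sub>C k) ` cball 0 (norm h)"
      by blast
  qed
qed

section \<open>Weyl's criterion for the essential spectrum\<close>

text \<open>\<open>T - z\<close> is, up to \<open>\<epsilon>\<close>, singular even after any finitely many directions are
  discarded. Almost-orthogonality to a finite set \<open>F\<close> replaces membership in a subspace of finite
  codimension, which spares orthogonal complements and adjoints of compact operators; as
  \<open>F\<close> may be rescaled, the bound \<open>1\<close> is as strong as any other positive bound. Keeping \<open>\<epsilon>\<close> as a
  parameter makes the notion stable under perturbations of \<open>T\<close>.\<close>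

definition essentially_singular ::
  "('a::complex_hilbert_space \<Rightarrow> 'a) \<Rightarrow> complex \<Rightarrow> real \<Rightarrow> bool" where
  "essentially_singular T z \<epsilon> \<longleftrightarrow>
     (\<forall>F. finite F \<longrightarrow>
       (\<exists>v. norm v = 1 \<and> norm (T v - z *\<^sub>C v) < \<epsilon> \<and> (\<forall>h\<in>F. cmod (cinner h v) < 1)))"

text \<open>If \<open>T - z\<close> is bounded below by \<open>\<epsilon>\<close> on unit vectors almost orthogonal to \<open>F\<close>, and \<open>Q\<close> is the
  finite-rank operator \<open>v \<mapsto> \<Sum>h\<in>F. \<langle>h, v\<rangle> h\<close>, then \<open>P = R' R + Q\<close>, with \<open>R = T - z\<close> and its adjoint
  \<open>R'\<close>, is coercive, hence invertible, and \<open>inverse P \<circ> R'\<close> inverts \<open>R\<close> up to terms containing the compact factor \<open>Q\<close>.\<close>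

lemma not_in_essential_spectrum:
  assumes T: "selfadjoint_operator T" and \<epsilon>: "0 < \<epsilon>" and not: "\<not> essentially_singular T z \<epsilon>"
  shows "z \<notin> essential_spectrum T"
proof -
  obtain F where F: "finite F"
    "\<And>v. norm v = 1 \<Longrightarrow> \<epsilon> \<le> norm (T v - z *\<^sub>C v) \<or> (\<exists>h\<in>F. 1 \<le> cmod (cinner h v))"
    using not unfolding essentially_singular_def by (auto simp: not_less)
  define R where "R v = T v - z *\<^sub>C v" for v
  define R' where "R' v = T v - cnj z *\<^sub>C v" for v
  define Q where "Q v = (\<Sum>h\<in>F. cinner h v *\<^sub>C h)" for v
  define P where "P v = R' (R v) + Q v" for v
  have R: "bounded_operator R" and R': "bounded_operator R'"
    unfolding R_def[abs_def] R'_def[abs_def]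
    by (intro bounded_operator_shift selfadjoint_bounded[OF T])+
  have Q_cpt: "compact_operator Q"
    unfolding Q_def[abs_def] by (intro compact_operator_sum compact_operator_rank_one)
  have Q: "bounded_operator Q"
    by (rule compact_operator_bounded[OF Q_cpt])
  have P: "bounded_operator P"
    unfolding P_def[abs_def] by (rule bounded_operator_add[OF bounded_operator_compose[OF R' R] Q])
  have adj: "cinner u (R' v) = cinner (R u) v" for u v
    by (simp add: R_def R'_def cinner_diff_left cinner_diff_right cinner_scaleC_left
        cinner_scaleC_right selfadjoint_cinner[OF T])
  have form: "Re (cinner v (P v)) = (norm (R v))\<^sup>2 + (\<Sum>h\<in>F. (cmod (cinner h v))\<^sup>2)" for v
    by (simp add: P_def Q_def cinner_add_right adj cinner_sum_right cinner_scaleC_right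
        cinner_swap_self cinner_self)
  define \<kappa> where "\<kappa> = min (\<epsilon>\<^sup>2) 1"
  have \<kappa>: "0 < \<kappa>"
    using \<epsilon> by (simp add: \<kappa>_def)
  have unit: "\<kappa> \<le> Re (cinner u (P u))" if "norm u = 1" for u
    using F(2)[OF that]
  proof
    assume "\<epsilon> \<le> norm (T u - z *\<^sub>C u)"
    then have "\<epsilon>\<^sup>2 \<le> (norm (R u))\<^sup>2"
      using \<epsilon> by (auto simp: R_def intro: power_mono)
    moreover have "0 \<le> (\<Sum>h\<in>F. (cmod (cinner h u))\<^sup>2)"
      by (intro sum_nonneg) auto
    ultimately show ?thesis
      by (simp add: form \<kappa>_def)
  next
    assume "\<exists>h\<in>F. 1 \<le> cmod (cinner h u)"
    then obtain h where h: "h \<in> F" "1 \<le> cmod (cinner h u)" ..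
    then have "1 \<le> (cmod (cinner h u))\<^sup>2"
      by (simp add: one_le_power)
    also have "\<dots> \<le> (\<Sum>h\<in>F. (cmod (cinner h u))\<^sup>2)"
      using h(1) F(1) by (intro member_le_sum) auto
    finally show ?thesis
      by (simp add: form \<kappa>_def add_increasing)
  qed
  have "\<kappa> * (norm v)\<^sup>2 \<le> Re (cinner v (P v))" for v
    by (rule quadratic_bound_from_unit_vectors[OF unit])
      (simp_all add: bounded_operator_simps[OF P] cinner_scaleR_left cinner_scaleR_right power2_eq_square)
  from coercive_invertible[OF P \<kappa> this]
  obtain G where G: "bounded_operator G" "\<And>v. G (P v) = v" "\<And>v. P (G v) = v"
    by blast
  note simps = bounded_operator_simps[OF R] bounded_operator_simps[OF R']
    bounded_operator_simps[OF Q] bounded_operator_simps[OF G(1)]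
  define S where "S v = G (R' v)" for v
  have S: "bounded_operator S"
    unfolding S_def[abs_def] by (rule bounded_operator_compose[OF G(1) R'])
  have left: "S (R v) - v = - G (Q v)" for v
    using G(2)[of v] by (simp add: S_def P_def simps algebra_simps)
  have commute: "R (R' v) = R' (R v)" for v
  proof -
    note T_simps = bounded_operator_simps(2,6)[OF selfadjoint_bounded[OF T]]
    have "R (R' v) = T (T v) - cnj z *\<^sub>C T v - (z *\<^sub>C T v - (z * cnj z) *\<^sub>C v)"
      by (simp add: R_def R'_def T_simps scaleC_diff_right scaleC_scaleC)
    also have "\<dots> = T (T v) - z *\<^sub>C T v - (cnj z *\<^sub>C T v - (cnj z * z) *\<^sub>C v)"
      by (simp add: mult.commute)
    also have "\<dots> = R' (R v)"
      by (simp add: R_def R'_def T_simps scaleC_diff_right scaleC_scaleC)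
    finally show ?thesis .
  qed
  \<comment> \<open>The commutator of \<open>R\<close> with \<open>P\<close> is that of \<open>R\<close> with \<open>Q\<close>, since \<open>R\<close> and its adjoint commute.\<close>
  have right: "R (S v) - v = G (Q (R (S v)) - R (Q (S v)) - Q v)" for v
  proof -
    have "R' v = R' (R (S v)) + Q (S v)"
      using G(3)[of "R' v"] by (simp add: S_def P_def)
    then have "R' (R (R (S v))) = R (R' v - Q (S v))"
      by (simp add: commute)
    then have "P (R (S v) - v) = Q (R (S v)) - R (Q (S v)) - Q v"
      by (simp add: P_def simps commute)
    then show ?thesis
      using G(2) by metis
  qed
  have "compact_operator (\<lambda>v. S (T v - z *\<^sub>C v) - v)"
    unfolding R_def[symmetric] left
    by (rule compact_operator_uminus[OF compact_operator_compose_left[OF G(1) Q_cpt]])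
  moreover have "compact_operator (\<lambda>v. T (S v) - z *\<^sub>C S v - v)"
  proof -
    have "compact_operator (\<lambda>v. Q (R (S v)))"
      by (rule compact_operator_compose_right[OF Q_cpt bounded_operator_compose[OF R S]])
    moreover have "compact_operator (\<lambda>v. R (Q (S v)))"
      by (rule compact_operator_compose_left[OF R compact_operator_compose_right[OF Q_cpt S]])
    ultimately have "compact_operator (\<lambda>v. G (Q (R (S v)) - R (Q (S v)) - Q v))"
      by (intro compact_operator_compose_left[OF G(1)] compact_operator_diff Q_cpt)
    then show ?thesis
      unfolding R_def[symmetric] right .
  qed
  ultimately show ?thesis
    using S unfolding essential_spectrum_def by blast
qed

text \<open>Each vector is chosen after the earlier ones, which, divided by \<open>\<eta>\<close>, form the finite set to
  which it has to be almost orthogonal.\<close>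

lemma almost_orthonormal_sequence:
  fixes T :: "'a::complex_hilbert_space \<Rightarrow> 'a"
  assumes sing: "\<And>k. essentially_singular T z (\<epsilon> k)" and \<eta>: "0 < \<eta>"
  shows "\<exists>u::nat \<Rightarrow> 'a. (\<forall>k. norm (u k) = 1 \<and> norm (T (u k) - z *\<^sub>C u k) < \<epsilon> k) \<and>
    (\<forall>i k. i < k \<longrightarrow> cmod (cinner (u i) (u k)) < \<eta>)"
proof -
  define good where "good f k v \<longleftrightarrow> norm v = 1 \<and> norm (T v - z *\<^sub>C v) < \<epsilon> k \<and>
    (\<forall>i<k. cmod (cinner (f i) v) < \<eta>)" for f :: "nat \<Rightarrow> 'a" and k v
  have "\<exists>u. \<forall>k. good u k (u k)"
  proof (rule dependent_wf_choice[of less_than])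
    show "\<exists>v. good f k v" for f k
    proof -
      have "finite ((\<lambda>i. (1 / \<eta>) *\<^sub>R f i) ` {..<k})"
        by simp
      with sing[of k] obtain v where v: "norm v = 1" "norm (T v - z *\<^sub>C v) < \<epsilon> k"
        "\<forall>h\<in>(\<lambda>i. (1 / \<eta>) *\<^sub>R f i) ` {..<k}. cmod (cinner h v) < 1"
        unfolding essentially_singular_def by blast
      have "cmod (cinner (f i) v) < \<eta>" if "i < k" for i
      proof -
        have "cmod (cinner ((1 / \<eta>) *\<^sub>R f i) v) < 1"
          using v(3) that by blast
        with \<eta> show ?thesis
          by (simp add: cinner_scaleR_left norm_mult norm_divide)
      qed
      with v(1,2) show ?thesis
        by (auto simp: good_def)
    qed
  qed (auto simp: good_def)
  then show ?thesis
    unfolding good_def by blast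
qed

text \<open>For an almost orthonormal sequence \<open>u k\<close> with \<open>(T - z) (u k) \<longlonglongrightarrow> 0\<close>, a left inverse of \<open>T - z\<close>
  modulo a compact \<open>K\<close> gives \<open>u k + K (u k) \<longlonglongrightarrow> 0\<close>. Compactness of \<open>K\<close> then yields a convergent
  subsequence of \<open>u\<close>, although its members stay at distance at least \<open>1\<close> from each other.\<close>

lemma in_essential_spectrum:
  fixes T :: "'a::complex_hilbert_space \<Rightarrow> 'a"
  assumes sing: "\<And>\<epsilon>. 0 < \<epsilon> \<Longrightarrow> essentially_singular T z \<epsilon>"
  shows "z \<in> essential_spectrum T"
proof (rule ccontr)
  assume "z \<notin> essential_spectrum T"
  then obtain S where S: "bounded_operator S"
    and K: "compact_operator (\<lambda>v. S (T v - z *\<^sub>C v) - v)"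
    by (auto simp: essential_spectrum_def)
  define K where "K v = S (T v - z *\<^sub>C v) - v" for v
  have "\<exists>u::nat \<Rightarrow> 'a. (\<forall>k. norm (u k) = 1 \<and> norm (T (u k) - z *\<^sub>C u k) < 1 / real (Suc k)) \<and>
      (\<forall>i k. i < k \<longrightarrow> cmod (cinner (u i) (u k)) < 1 / 2)"
    by (rule almost_orthonormal_sequence) (use sing in auto)
  then obtain u :: "nat \<Rightarrow> 'a" where u: "\<And>k. norm (u k) = 1"
    "\<And>k. norm (T (u k) - z *\<^sub>C u k) < 1 / real (Suc k)"
    "\<And>i k. i < k \<Longrightarrow> cmod (cinner (u i) (u k)) < 1 / 2"
    by blast
  have "compact_operator K"
    using K unfolding K_def[abs_def] .
  then have "seq_compact (closure (K ` cball 0 1))" "\<forall>k. K (u k) \<in> closure (K ` cball 0 1)"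
    using compact_operator_image[of K] u(1)
    by (simp_all add: compact_operator_def compact_eq_seq_compact_metric)
  then obtain l r where r: "strict_mono r" "((\<lambda>k. K (u k)) \<circ> r) \<longlonglongrightarrow> l"
    by (rule seq_compactE)
  have "(\<lambda>k. T (u k) - z *\<^sub>C u k) \<longlonglongrightarrow> 0"
    using u(2) by (intro Lim_null_comparison[OF _ LIMSEQ_inverse_real_of_nat])
      (auto simp: inverse_eq_divide intro!: always_eventually less_imp_le)
  then have "(\<lambda>k. S (T (u k) - z *\<^sub>C u k)) \<longlonglongrightarrow> S 0"
    by (rule bounded_linear.tendsto[OF bounded_operator_linear[OF S]])
  then have "((\<lambda>k. S (T (u k) - z *\<^sub>C u k)) \<circ> r) \<longlonglongrightarrow> S 0"
    using r(1) by (rule LIMSEQ_subseq_LIMSEQ)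
  from tendsto_diff[OF this r(2)] have "(\<lambda>k. u (r k)) \<longlonglongrightarrow> S 0 - l"
    by (simp add: K_def o_def)
  then have "Cauchy (\<lambda>k. u (r k))"
    by (rule LIMSEQ_imp_Cauchy)
  then have "\<exists>N. \<forall>i\<ge>N. \<forall>k\<ge>N. norm (u (r i) - u (r k)) < 1"
    by (rule CauchyD) simp
  then obtain N where N: "\<forall>i\<ge>N. \<forall>k\<ge>N. norm (u (r i) - u (r k)) < 1" ..
  have less: "r N < r (Suc N)"
    using r(1) by (simp add: strict_mono_less)
  have "(norm (u (r N) - u (r (Suc N))))\<^sup>2 < 1"
    using N by (simp add: power_less_one_iff)
  moreover have "Re (cinner (u (r N)) (u (r (Suc N)))) < 1 / 2"
    using u(3)[OF less] complex_Re_le_cmod order.strict_trans1 by blast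
  ultimately show False
    by (simp add: norm_diff_sq u(1))
qed

lemma essentially_singular_perturb:
  assumes sing: "essentially_singular S z \<epsilon>"
    and close: "\<And>v. norm (S v - T v) \<le> \<eta> * norm v"
  shows "essentially_singular T z (\<epsilon> + \<eta>)"
  unfolding essentially_singular_def
proof (intro allI impI)
  fix F :: "'a set"
  assume "finite F"
  with sing obtain v where v: "norm v = 1" "norm (S v - z *\<^sub>C v) < \<epsilon>" "\<forall>h\<in>F. cmod (cinner h v) < 1"
    unfolding essentially_singular_def by blast
  have "norm (T v - z *\<^sub>C v) < \<epsilon> + \<eta>"
    using norm_triangle_ineq4[of "S v - z *\<^sub>C v" "S v - T v"] v close[of v] by simp
  with v show "\<exists>v. norm v = 1 \<and> norm (T v - z *\<^sub>C v) < \<epsilon> + \<eta> \<and> (\<forall>h\<in>F. cmod (cinner h v) < 1)"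
    by blast
qed

lemma essential_spectrum_norm_le:
  assumes T: "selfadjoint_operator T" and B: "\<And>v. norm (T v) \<le> B * norm v"
    and z: "z \<in> essential_spectrum T"
  shows "cmod z \<le> B"
proof (rule ccontr)
  assume "\<not> cmod z \<le> B"
  with not_in_essential_spectrum[OF T, of "cmod z - B" z] z
  have "essentially_singular T z (cmod z - B)"
    by auto
  then obtain v where v: "norm v = 1" "norm (T v - z *\<^sub>C v) < cmod z - B"
    unfolding essentially_singular_def by blast
  show False
    using norm_triangle_ineq2[of "z *\<^sub>C v" "T v"] B[of v] v
    by (simp add: norm_scaleC norm_minus_commute)
qed

lemma op_spectrum_approximate_eigenvalue:
  assumes "\<And>\<epsilon>. 0 < \<epsilon> \<Longrightarrow> \<exists>v. norm v = 1 \<and> norm (T v - z *\<^sub>C v) < \<epsilon>"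
  shows "z \<in> op_spectrum T"
proof (rule ccontr)
  assume "z \<notin> op_spectrum T"
  then obtain S where S: "bounded_operator S" "\<And>v. S (T v - z *\<^sub>C v) = v"
    by (auto simp: op_spectrum_def)
  obtain M where M: "0 < M" "\<And>v. norm (S v) \<le> M * norm v"
    using bounded_operator_bound[OF S(1)] by blast
  obtain v where v: "norm v = 1" "norm (T v - z *\<^sub>C v) < 1 / M"
    using assms[of "1 / M"] M(1) by auto
  have "1 \<le> M * norm (T v - z *\<^sub>C v)"
    using M(2)[of "T v - z *\<^sub>C v"] by (simp add: S(2) v(1))
  with v(2) M(1) show False
    by (simp add: field_simps)
qed

section \<open>The bottom of the spectrum\<close>

text \<open>The infimum of the numerical range, taken over unit vectors almost orthogonal to any prescribed
  finite subset of \<open>X\<close>, is an approximate eigenvalue with approximate eigenvectors of the same kind.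
  With \<open>X = {0}\<close> it is the infimum of the spectrum, with \<open>X = UNIV\<close> that of the essential spectrum.

  The reason is the Cauchy--Schwarz inequality for nonnegative forms. Let \<open>t\<close> be the infimum and
  \<open>W = T - (t - \<theta>)\<close>. A finite set \<open>F0 \<subseteq> X\<close> witnesses that \<open>t - \<theta>\<close> is below the infimum, so the form
  of \<open>W\<close> plus \<open>M \<Sum>h\<in>F0. |\<langle>h, v\<rangle>|\<^sup>2\<close> is nonnegative. Evaluated at \<open>v - W v / M\<close>, where
  \<open>\<langle>v, W v\<rangle> \<le> 2 \<theta>\<close>, this gives \<open>\<parallel>W v\<parallel>\<^sup>2 \<le> 2 \<theta> M\<close> up to the terms with \<open>F0\<close>. These terms only
  involve products of \<open>v\<close> with the vectors \<open>h - W h / M\<close> of \<open>X\<close>, so they are small if \<open>v\<close> is almost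
  orthogonal to large multiples of them.\<close>

lemma bottom_is_approximate_eigenvalue:
  fixes T :: "'a::complex_hilbert_space \<Rightarrow> 'a"
  assumes T: "selfadjoint_operator T" and X: "Real_Vector_Spaces.subspace X" "\<And>h. h \<in> X \<Longrightarrow> T h \<in> X"
    and s: "\<And>F. finite F \<Longrightarrow> F \<subseteq> X \<Longrightarrow>
      \<exists>v. norm v = 1 \<and> (\<forall>h\<in>F. cmod (cinner h v) < 1) \<and> Re (cinner v (T v)) \<le> s"
  obtains t where "t \<le> s"
    "\<And>\<epsilon> F. 0 < \<epsilon> \<Longrightarrow> finite F \<Longrightarrow> F \<subseteq> X \<Longrightarrow>
      \<exists>v. norm v = 1 \<and> norm (T v - complex_of_real t *\<^sub>C v) < \<epsilon> \<and> (\<forall>h\<in>F. cmod (cinner h v) < 1)"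
proof -
  define low where "low r \<longleftrightarrow> (\<forall>F. finite F \<and> F \<subseteq> X \<longrightarrow>
    (\<exists>v. norm v = 1 \<and> (\<forall>h\<in>F. cmod (cinner h v) < 1) \<and> Re (cinner v (T v)) \<le> r))" for r
  note T_simps = bounded_operator_simps[OF selfadjoint_bounded[OF T]]
  obtain B where B: "0 < B" "\<And>v. norm (T v) \<le> B * norm v"
    using bounded_operator_bound[OF selfadjoint_bounded[OF T]] by blast
  define t where "t = Inf {r. low r}"
  have low_s: "low s"
    using s by (auto simp: low_def)
  have "- B \<le> r" if "low r" for r
  proof -
    obtain v where v: "norm v = 1" "Re (cinner v (T v)) \<le> r"
      using \<open>low r\<close>[unfolded low_def, THEN spec, of "{}"] by auto
    have "\<bar>Re (cinner v (T v))\<bar> \<le> B"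
      using abs_Re_le_cmod[of "cinner v (T v)"] cauchy_schwarz[of v "T v"] B(2)[of v] v(1) by simp
    with v(2) show ?thesis
      by simp
  qed
  then have bdd: "bdd_below {r. low r}"
    by (auto simp: bdd_below_def)
  have "t \<le> s"
    unfolding t_def using low_s bdd by (intro cInf_lower) auto
  moreover
  have "\<exists>v. norm v = 1 \<and> norm (T v - complex_of_real t *\<^sub>C v) < \<epsilon> \<and> (\<forall>h\<in>F. cmod (cinner h v) < 1)"
    if \<epsilon>: "0 < \<epsilon>" and F: "finite F" "F \<subseteq> X" for \<epsilon> F
  proof -
    define M where "M = B + \<bar>t\<bar> + 1"
    define \<theta> where "\<theta> = min 1 (min (\<epsilon> / 2) (\<epsilon>\<^sup>2 / (16 * M)))"
    have M: "0 < M"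
      using B(1) by (simp add: M_def)
    have \<theta>: "0 < \<theta>" "\<theta> \<le> 1" "\<theta> \<le> \<epsilon> / 2" "\<theta> \<le> \<epsilon>\<^sup>2 / (16 * M)"
      using \<epsilon> M by (auto simp: \<theta>_def)
    then have M_\<theta>: "M * \<theta> \<le> \<epsilon>\<^sup>2 / 16"
      using M by (simp add: field_simps)
    define W where "W u = T u - (t - \<theta>) *\<^sub>R u" for u
    have W_cinner: "cinner (W u) v = cinner u (W v)" for u v
      by (simp add: W_def cinner_diff_left cinner_diff_right cinner_scaleR_left cinner_scaleR_right
          selfadjoint_cinner[OF T])
    have W_norm: "norm (W u) \<le> M * norm u" for u
    proof -
      have "norm (W u) \<le> B * norm u + \<bar>t - \<theta>\<bar> * norm u"
        unfolding W_def using norm_triangle_ineq4[of "T u" "(t - \<theta>) *\<^sub>R u"] B(2)[of u] by simp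
      also have "\<dots> = (B + \<bar>t - \<theta>\<bar>) * norm u"
        by (simp add: algebra_simps)
      also have "\<dots> \<le> M * norm u"
        using \<theta> by (intro mult_right_mono) (auto simp: M_def)
      finally show ?thesis .
    qed
    have W_form: "\<bar>Re (cinner u (W u))\<bar> \<le> M * (norm u)\<^sup>2" for u
      using abs_Re_le_cmod[of "cinner u (W u)"] cauchy_schwarz[of u "W u"]
        mult_left_mono[OF W_norm[of u] norm_ge_zero[of u]]
      by (simp add: power2_eq_square mult_ac)
    have "\<not> low (t - \<theta>)"
      using cInf_lower[of "t - \<theta>" "{r. low r}"] bdd \<theta>(1) by (auto simp: t_def)
    then obtain F0 where F0: "finite F0" "F0 \<subseteq> X"
      "\<not> (\<exists>u. norm u = 1 \<and> (\<forall>h\<in>F0. cmod (cinner h u) < 1) \<and> Re (cinner u (T u)) \<le> t - \<theta>)"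
      unfolding low_def by blast
    have F0_above: "t - \<theta> < Re (cinner u (T u))"
      if "norm u = 1" "\<forall>h\<in>F0. cmod (cinner h u) < 1" for u
      using F0(3) that by (meson not_le)
    have "0 * (norm u)\<^sup>2 \<le> Re (cinner u (W u)) + M * (\<Sum>h\<in>F0. (cmod (cinner h u))\<^sup>2)" for u
    proof (rule quadratic_bound_from_unit_vectors)
      fix u :: 'a
      assume u: "norm u = 1"
      have sum_nonneg: "0 \<le> (\<Sum>h\<in>F0. (cmod (cinner h u))\<^sup>2)"
        by (intro sum_nonneg) auto
      show "0 \<le> Re (cinner u (W u)) + M * (\<Sum>h\<in>F0. (cmod (cinner h u))\<^sup>2)"
      proof (cases "\<forall>h\<in>F0. cmod (cinner h u) < 1")
        case True
        then have "0 \<le> Re (cinner u (W u))"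
          using F0_above[OF u] u by (simp add: W_def cinner_diff_right cinner_scaleR_right cinner_self)
        with M sum_nonneg show ?thesis
          by simp
      next
        case False
        then obtain h where h: "h \<in> F0" "1 \<le> cmod (cinner h u)"
          by (auto simp: not_less)
        have "1 \<le> (cmod (cinner h u))\<^sup>2"
          using h(2) by (simp add: one_le_power)
        also have "\<dots> \<le> (\<Sum>h\<in>F0. (cmod (cinner h u))\<^sup>2)"
          using h(1) F0(1) by (intro member_le_sum) auto
        finally have "M * 1 \<le> M * (\<Sum>h\<in>F0. (cmod (cinner h u))\<^sup>2)"
          using M by (intro mult_left_mono) auto
        with W_form[of u] u show ?thesis
          by simp
      qed
    next
      fix r u
      have "W (r *\<^sub>R u) = r *\<^sub>R W u"
        by (simp add: W_def T_simps algebra_simps)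
      then have "Re (cinner (r *\<^sub>R u) (W (r *\<^sub>R u))) = r\<^sup>2 * Re (cinner u (W u))"
        by (simp add: cinner_scaleR_left cinner_scaleR_right power2_eq_square)
      moreover have "(cmod (cinner h (r *\<^sub>R u)))\<^sup>2 = r\<^sup>2 * (cmod (cinner h u))\<^sup>2" for h
        by (simp add: cinner_scaleR_right norm_mult power_mult_distrib)
      ultimately show "Re (cinner (r *\<^sub>R u) (W (r *\<^sub>R u))) + M * (\<Sum>h\<in>F0. (cmod (cinner h (r *\<^sub>R u)))\<^sup>2)
          = r\<^sup>2 * (Re (cinner u (W u)) + M * (\<Sum>h\<in>F0. (cmod (cinner h u))\<^sup>2))"
        by (simp add: distrib_left mult.left_commute flip: sum_distrib_left)
    qed
    then have form: "0 \<le> Re (cinner u (W u)) + M * (\<Sum>h\<in>F0. (cmod (cinner h u))\<^sup>2)" for u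
      by simp
    have "\<exists>r\<in>{r. low r}. r < t + \<theta>"
      using cInf_lessD[of "{r. low r}" "t + \<theta>"] low_s \<theta>(1) by (auto simp: t_def)
    then obtain r where r: "low r" "r < t + \<theta>"
      by blast
    \<comment> \<open>Almost-orthogonality to \<open>k\<close> times a vector makes the terms with \<open>F0\<close> add up to at most \<open>\<theta>\<close>.\<close>
    define k where "k = 1 + M * real (card F0) / \<theta>"
    have k: "1 \<le> k"
      using M \<theta> by (simp add: k_def)
    have k2: "M * real (card F0) \<le> \<theta> * k\<^sup>2"
    proof -
      have "M * real (card F0) \<le> \<theta> * k"
        using \<theta> by (simp add: k_def field_simps)
      also have "\<dots> \<le> \<theta> * k\<^sup>2"
        using k \<theta> by (simp add: self_le_power)
      finally show ?thesis .
    qed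
    \<comment> \<open>Self-adjointness moves the map \<open>v \<mapsto> v - W v / M\<close> from \<open>v\<close> to the vectors of \<open>F0\<close>.\<close>
    define g where "g h = h - (1 / M) *\<^sub>R W h" for h
    have "(\<lambda>h. k *\<^sub>R g h) ` F0 \<subseteq> X"
      using F0(2) X(2) by (auto simp: g_def W_def intro!: real_vector.subspace_scale[OF X(1)] real_vector.subspace_diff[OF X(1)])
    with r(1) F F0(1) obtain v where v: "norm v = 1"
      "\<forall>h\<in>F \<union> (\<lambda>h. k *\<^sub>R g h) ` F0. cmod (cinner h v) < 1" "Re (cinner v (T v)) \<le> r"
      unfolding low_def by (metis finite_UnI finite_imageI le_sup_iff)
    define u where "u = v - (1 / M) *\<^sub>R W v"
    have "Re (cinner u (W u))
        = Re (cinner v (W v)) - 2 / M * (norm (W v))\<^sup>2 + 1 / M\<^sup>2 * Re (cinner (W v) (W (W v)))"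
    proof -
      have "W (x - y) = W x - W y" "W (a *\<^sub>R x) = a *\<^sub>R W x" for x y a
        by (simp_all add: W_def T_simps algebra_simps)
      then have W_u: "W u = W v - (1 / M) *\<^sub>R W (W v)"
        by (simp add: u_def)
      have "cinner u (W u) = cinner v (W v) - of_real (1 / M) * cinner v (W (W v))
          - of_real (1 / M) * cinner (W v) (W v) + of_real (1 / M\<^sup>2) * cinner (W v) (W (W v))"
        unfolding W_u
        by (simp add: u_def cinner_diff_left cinner_diff_right cinner_scaleR_left cinner_scaleR_right
            power2_eq_square algebra_simps)
      also have "cinner v (W (W v)) = cinner (W v) (W v)"
        by (simp add: W_cinner)
      finally show ?thesis
        by (simp add: cinner_self)
    qed
    also have "\<dots> \<le> 2 * \<theta> - 2 / M * (norm (W v))\<^sup>2 + 1 / M\<^sup>2 * (M * (norm (W v))\<^sup>2)"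
    proof (intro add_mono diff_mono mult_left_mono)
      show "Re (cinner v (W v)) \<le> 2 * \<theta>"
        using v r(2) by (simp add: W_def cinner_diff_right cinner_scaleR_right cinner_self)
      show "Re (cinner (W v) (W (W v))) \<le> M * (norm (W v))\<^sup>2"
        using W_form[of "W v"] by simp
    qed (use M in auto)
    also have "\<dots> = 2 * \<theta> - (norm (W v))\<^sup>2 / M"
      using M by (simp add: field_simps power2_eq_square)
    finally have upper: "Re (cinner u (W u)) \<le> 2 * \<theta> - (norm (W v))\<^sup>2 / M" .
    have "(\<Sum>h\<in>F0. (cmod (cinner h u))\<^sup>2) \<le> (\<Sum>h\<in>F0. 1 / k\<^sup>2)"
    proof (rule sum_mono)
      fix h
      assume "h \<in> F0"
      have "cinner h u = cinner (g h) v"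
        by (simp add: u_def g_def cinner_diff_left cinner_diff_right cinner_scaleR_left
            cinner_scaleR_right W_cinner)
      moreover have "cmod (cinner (k *\<^sub>R g h) v) < 1"
        using v(2) \<open>h \<in> F0\<close> by blast
      then have "k * cmod (cinner (g h) v) < 1"
        using k by (simp add: cinner_scaleR_left norm_mult)
      ultimately have "cmod (cinner h u) \<le> 1 / k"
        using k by (simp add: field_simps)
      then show "(cmod (cinner h u))\<^sup>2 \<le> 1 / k\<^sup>2"
        using power_mono[of "cmod (cinner h u)" "1 / k" 2] by (simp add: power_divide)
    qed
    then have "M * (\<Sum>h\<in>F0. (cmod (cinner h u))\<^sup>2) \<le> M * (real (card F0) / k\<^sup>2)"
      using M by (intro mult_left_mono) auto
    also have "\<dots> \<le> \<theta>"
      using k2 k by (simp add: field_simps)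
    finally have "(norm (W v))\<^sup>2 / M \<le> 3 * \<theta>"
      using form[of u] upper by linarith
    then have "(norm (W v))\<^sup>2 \<le> 3 * (M * \<theta>)"
      using M by (simp add: field_simps)
    also have "\<dots> < \<epsilon>\<^sup>2 / 4"
      using M_\<theta> zero_less_power[OF \<epsilon>, of 2] by linarith
    also have "\<dots> = (\<epsilon> / 2)\<^sup>2"
      by (simp add: power_divide)
    finally have "norm (W v) < \<epsilon> / 2"
      by (rule power_less_imp_less_base) (use \<epsilon> in simp)
    moreover have "T v - complex_of_real t *\<^sub>C v = W v - \<theta> *\<^sub>R v"
      by (simp add: W_def scaleC_of_real algebra_simps)
    ultimately have "norm (T v - complex_of_real t *\<^sub>C v) < \<epsilon>"
      using norm_triangle_ineq4[of "W v" "\<theta> *\<^sub>R v"] \<theta> v(1) by simp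
    with v show ?thesis
      by blast
  qed
  ultimately show ?thesis
    by (rule that)
qed

lemma selfadjoint_uminus: "selfadjoint_operator T \<Longrightarrow> selfadjoint_operator (\<lambda>v. - T v)"
  by (simp add: selfadjoint_operator_def bounded_operator_uminus cinner_minus_left cinner_minus_right)

lemma norm_uminus_shift: "norm (- T v - z *\<^sub>C v) = norm (T v - (- z) *\<^sub>C (v::'a::complex_hilbert_space))"
  by (metis (no_types, opaque_lifting) minus_diff_eq minus_minus norm_minus_commute scaleC_minus_left
      add.commute diff_minus_eq_add)

lemma op_spectrum_below_numerical_value:
  assumes T: "selfadjoint_operator T" and v: "norm v = 1"
  obtains t where "t \<le> Re (cinner v (T v))" "complex_of_real t \<in> op_spectrum T"
proof -
  obtain t where t: "t \<le> Re (cinner v (T v))" "\<And>\<epsilon> F. 0 < \<epsilon> \<Longrightarrow> finite F \<Longrightarrow> F \<subseteq> {0} \<Longrightarrow>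
      \<exists>v. norm v = 1 \<and> norm (T v - complex_of_real t *\<^sub>C v) < \<epsilon> \<and> (\<forall>h\<in>F. cmod (cinner h v) < 1)"
  proof (rule bottom_is_approximate_eigenvalue[OF T, of "{0}" "Re (cinner v (T v))"])
    show "\<exists>u. norm u = 1 \<and> (\<forall>h\<in>F. cmod (cinner h u) < 1) \<and> Re (cinner u (T u)) \<le> Re (cinner v (T v))"
      if "F \<subseteq> {0}" for F
      using v that by (intro exI[of _ v]) auto
  qed (auto simp: bounded_operator_simps[OF selfadjoint_bounded[OF T]])
  have "complex_of_real t \<in> op_spectrum T"
    using t(2)[where F="{}"] by (intro op_spectrum_approximate_eigenvalue) auto
  with t(1) show ?thesis
    by (rule that)
qed

lemma op_spectrum_uminus:
  assumes T: "bounded_operator T" and z: "z \<in> op_spectrum (\<lambda>v. - T v)"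
  shows "- z \<in> op_spectrum T"
proof (rule ccontr)
  assume "- z \<notin> op_spectrum T"
  then obtain S where S: "bounded_operator S"
    "\<And>v. S (T v + z *\<^sub>C v) = v" "\<And>v. T (S v) + z *\<^sub>C S v = v"
    by (auto simp: op_spectrum_def scaleC_minus_left)
  have "- S (- T v - z *\<^sub>C v) = v" for v
    using S(2)[of v] bounded_operator_simps(3)[OF S(1), of "- T v - z *\<^sub>C v"]
    by (simp add: add.commute)
  moreover have "- T (- S v) - z *\<^sub>C (- S v) = v" for v
    using S(3)[of v] by (simp add: bounded_operator_simps[OF T] scaleC_minus_right)
  ultimately show False
    using z bounded_operator_uminus[OF S(1)] by (auto simp: op_spectrum_def)
qed

text \<open>The top of the spectrum of \<open>T\<close> is the bottom of the spectrum of \<open>- T\<close>.\<close>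

lemma op_spectrum_above_numerical_value:
  assumes T: "selfadjoint_operator T" and v: "norm v = 1"
  obtains t where "Re (cinner v (T v)) \<le> t" "complex_of_real t \<in> op_spectrum T"
proof -
  obtain t where t: "t \<le> Re (cinner v (- T v))" "complex_of_real t \<in> op_spectrum (\<lambda>v. - T v)"
    using op_spectrum_below_numerical_value[OF selfadjoint_uminus[OF T] v] by blast
  have "complex_of_real (- t) \<in> op_spectrum T"
    using op_spectrum_uminus[OF selfadjoint_bounded[OF T] t(2)] by simp
  with t(1) show ?thesis
    by (intro that[of "- t"]) (auto simp: cinner_minus_right)
qed

text \<open>A parameter \<open>m\<close> at which \<open>T\<close> is essentially singular only up to a fixed \<open>\<epsilon>\<close> need not be in the
  essential spectrum, but it shows that the essential spectrum begins no later than \<open>m + \<epsilon>\<close>. This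
  is how points of the essential spectrum on either side of a gap survive a perturbation.\<close>

lemma essential_point_below:
  assumes T: "selfadjoint_operator T" and sing: "essentially_singular T (complex_of_real m) \<epsilon>"
  obtains t where "t \<le> m + \<epsilon>" "\<And>\<epsilon>'. 0 < \<epsilon>' \<Longrightarrow> essentially_singular T (complex_of_real t) \<epsilon>'"
proof -
  obtain t where t: "t \<le> m + \<epsilon>" "\<And>\<epsilon> F. 0 < \<epsilon> \<Longrightarrow> finite F \<Longrightarrow> F \<subseteq> UNIV \<Longrightarrow>
      \<exists>v. norm v = 1 \<and> norm (T v - complex_of_real t *\<^sub>C v) < \<epsilon> \<and> (\<forall>h\<in>F. cmod (cinner h v) < 1)"
  proof (rule bottom_is_approximate_eigenvalue[OF T, of UNIV "m + \<epsilon>"])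
    fix F :: "'a set"
    assume "finite F"
    then obtain v where v: "norm v = 1" "norm (T v - complex_of_real m *\<^sub>C v) < \<epsilon>"
      "\<forall>h\<in>F. cmod (cinner h v) < 1"
      using sing unfolding essentially_singular_def by blast
    have "Re (cinner v (T v)) = Re (cinner v (T v - complex_of_real m *\<^sub>C v)) + m"
      using v(1) by (simp add: cinner_diff_right cinner_scaleC_right cinner_self)
    also have "\<dots> \<le> m + \<epsilon>"
      using complex_Re_le_cmod[of "cinner v (T v - complex_of_real m *\<^sub>C v)"]
        cauchy_schwarz[of v "T v - complex_of_real m *\<^sub>C v"] v(1,2) by simp
    finally show "\<exists>v. norm v = 1 \<and> (\<forall>h\<in>F. cmod (cinner h v) < 1) \<and> Re (cinner v (T v)) \<le> m + \<epsilon>"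
      using v by blast
  qed auto
  show ?thesis
    using t by (intro that[of t]) (auto simp: essentially_singular_def)
qed

lemma essentially_singular_uminus:
  "essentially_singular (\<lambda>v. - T v) z \<epsilon> = essentially_singular T (- z) \<epsilon>"
  by (simp add: essentially_singular_def norm_uminus_shift)

lemma essential_point_above:
  assumes T: "selfadjoint_operator T" and sing: "essentially_singular T (complex_of_real m) \<epsilon>"
  obtains t where "m - \<epsilon> \<le> t" "\<And>\<epsilon>'. 0 < \<epsilon>' \<Longrightarrow> essentially_singular T (complex_of_real t) \<epsilon>'"
proof -
  have "essentially_singular (\<lambda>v. - T v) (complex_of_real (- m)) \<epsilon>"
    using sing by (simp add: essentially_singular_uminus)
  then obtain t where t: "t \<le> - m + \<epsilon>"
    "\<And>\<epsilon>'. 0 < \<epsilon>' \<Longrightarrow> essentially_singular (\<lambda>v. - T v) (complex_of_real t) \<epsilon>'"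
    using essential_point_below[OF selfadjoint_uminus[OF T]] by blast
  then show ?thesis
    by (intro that[of "- t"]) (auto simp: essentially_singular_uminus)
qed

section \<open>Eigenvectors of the truncations\<close>

text \<open>A symmetric \<open>C\<close> that is triangular in a basis \<open>p\<close> of the fixed space of \<open>N\<close>, with coordinate functionals \<open>q\<close> and diagonal
  \<open>l\<close>, becomes diagonal, with the same diagonal, in the orthonormal basis that Gram--Schmidt produces
  from \<open>p\<close>. The induction goes along the invariant flag of the subspaces
  \<open>{v. \<forall>j\<ge>m. q j v = 0}\<close>: a new basis vector is orthogonal to the previous eigenvectors, so its
  image is too, by symmetry, and only the multiple given by the diagonal entry is left.\<close>

lemma triangular_selfadjoint_eigenbasis:
  fixes N C :: "'a::complex_hilbert_space \<Rightarrow> 'a" and q :: "nat \<Rightarrow> 'a \<Rightarrow> complex" and l :: "nat \<Rightarrow> real"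
  assumes N: "bounded_operator N" and C_range: "\<And>v. N (C v) = C v"
    and C_sym: "\<And>u v. cinner (C u) v = cinner u (C v)"
    and q_add: "\<And>k u v. q k (u + v) = q k u + q k v"
    and q_scale: "\<And>k c v. q k (c *\<^sub>C v) = c * q k v"
    and q_C: "\<And>k v. k < n \<Longrightarrow> q k (C v) = (\<Sum>j<n. b k j * q j v)"
    and triangular: "\<And>k j. j < k \<Longrightarrow> k < n \<Longrightarrow> b k j = 0"
    and diagonal: "\<And>k. k < n \<Longrightarrow> b k k = complex_of_real (l k)"
    and p: "\<And>k. k < n \<Longrightarrow> N (p k) = p k" "\<And>j k. j < n \<Longrightarrow> k < n \<Longrightarrow> q j (p k) = (if j = k then 1 else 0)"
    and total: "\<And>v. N v = v \<Longrightarrow> (\<And>k. k < n \<Longrightarrow> q k v = 0) \<Longrightarrow> v = 0"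
  obtains \<phi> :: "nat \<Rightarrow> 'a" where "\<And>i. i < n \<Longrightarrow> N (\<phi> i) = \<phi> i"
    "\<And>i. i < n \<Longrightarrow> C (\<phi> i) = complex_of_real (l i) *\<^sub>C \<phi> i"
    "\<And>i j. i < n \<Longrightarrow> j < n \<Longrightarrow> cinner (\<phi> i) (\<phi> j) = (if i = j then 1 else 0)"
    "\<And>v. N v = v \<Longrightarrow> v = (\<Sum>i<n. cinner (\<phi> i) v *\<^sub>C \<phi> i)"
proof -
  note N_simps = bounded_operator_simps[OF N]
  have q_zero: "q k 0 = 0" for k
    using q_scale[of k 0 0] by simp
  have q_minus: "q k (- v) = - q k v" for k v
    using q_add[of k v "- v"] by (simp add: q_zero add_eq_0_iff)
  have q_diff: "q k (u - v) = q k u - q k v" for k u v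
    using q_add[of k u "- v"] by (simp add: q_minus)
  have q_sum: "q k (\<Sum>i\<in>I. f i) = (\<Sum>i\<in>I. q k (f i))" for k and I :: "nat set" and f
    by (induction I rule: infinite_finite_induct) (simp_all add: q_zero q_add)
  define basis where "basis m \<phi> \<longleftrightarrow>
    (\<forall>i<m. N (\<phi> i) = \<phi> i \<and> C (\<phi> i) = complex_of_real (l i) *\<^sub>C \<phi> i \<and> (\<forall>j<n. i < j \<longrightarrow> q j (\<phi> i) = 0)) \<and>
    (\<forall>i<m. \<forall>j<m. cinner (\<phi> i) (\<phi> j) = (if i = j then 1 else 0)) \<and>
    (\<forall>v. N v = v \<and> (\<forall>j<n. m \<le> j \<longrightarrow> q j v = 0) \<longrightarrow> v = (\<Sum>i<m. cinner (\<phi> i) v *\<^sub>C \<phi> i))"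
    for m and \<phi> :: "nat \<Rightarrow> 'a"
  have "\<exists>\<phi>. basis m \<phi>" if "m \<le> n" for m
    using that
  proof (induction m)
    case 0
    show ?case
      using total by (auto simp: basis_def)
  next
    case (Suc k)
    then obtain \<phi> where \<phi>: "basis k \<phi>" and k: "k < n"
      by auto
    have \<phi>_N: "N (\<phi> i) = \<phi> i" and \<phi>_C: "C (\<phi> i) = complex_of_real (l i) *\<^sub>C \<phi> i"
      and \<phi>_q: "\<And>j. j < n \<Longrightarrow> i < j \<Longrightarrow> q j (\<phi> i) = 0" if "i < k" for i
      using \<phi> that by (auto simp: basis_def)
    have \<phi>_orth: "cinner (\<phi> i) (\<phi> j) = (if i = j then 1 else 0)" if "i < k" "j < k" for i j
      using \<phi> that by (simp add: basis_def)
    have \<phi>_span: "v = (\<Sum>i<k. cinner (\<phi> i) v *\<^sub>C \<phi> i)"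
      if "N v = v" "\<And>j. j < n \<Longrightarrow> k \<le> j \<Longrightarrow> q j v = 0" for v
      using \<phi> that by (simp add: basis_def)
    define x where "x = p k - (\<Sum>i<k. cinner (\<phi> i) (p k) *\<^sub>C \<phi> i)"
    have x_N: "N x = x"
      using k by (simp add: x_def N_simps p \<phi>_N)
    have x_q: "q j x = (if j = k then 1 else 0)" if "j < n" "k \<le> j" for j
      using k that by (simp add: x_def q_diff q_sum q_scale p \<phi>_q)
    have x_orth: "cinner (\<phi> i) x = 0" if "i < k" for i
    proof -
      have "(\<Sum>j<k. cinner (\<phi> j) (p k) * cinner (\<phi> i) (\<phi> j))
          = (\<Sum>j<k. if i = j then cinner (\<phi> j) (p k) else 0)"
        using that by (intro sum.cong) (auto simp: \<phi>_orth)
      with that show ?thesis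
        by (simp add: x_def cinner_diff_right cinner_sum_right cinner_scaleC_right)
    qed
    have "x \<noteq> 0"
      using x_q[of k] k by (auto simp: q_zero)
    define y where "y = complex_of_real (1 / norm x) *\<^sub>C x"
    have y_N: "N y = y"
      by (simp add: y_def N_simps x_N)
    have y_q: "q j y = (if j = k then complex_of_real (1 / norm x) else 0)" if "j < n" "k \<le> j" for j
      using that by (simp add: y_def q_scale x_q)
    have y_norm: "cinner y y = 1"
      using \<open>x \<noteq> 0\<close> by (simp add: y_def cinner_self norm_scaleC norm_divide)
    have y_orth: "cinner (\<phi> i) y = 0" "cinner y (\<phi> i) = 0" if "i < k" for i
      using x_orth[OF that] cinner_commute[of x "\<phi> i"]
      by (simp_all add: y_def cinner_scaleC_right cinner_scaleC_left)
    have y_span: "v = (\<Sum>i<k. cinner (\<phi> i) v *\<^sub>C \<phi> i) + cinner y v *\<^sub>C y"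
      if v: "N v = v" "\<And>j. j < n \<Longrightarrow> k < j \<Longrightarrow> q j v = 0" for v
    proof -
      define c where "c = q k v * complex_of_real (norm x)"
      have "N (v - c *\<^sub>C y) = v - c *\<^sub>C y"
        by (simp add: N_simps v(1) y_N)
      moreover have "q j (v - c *\<^sub>C y) = 0" if "j < n" "k \<le> j" for j
        using that \<open>x \<noteq> 0\<close> v(2)[of j] by (cases "j = k") (auto simp: q_diff q_scale y_q c_def)
      ultimately have "v - c *\<^sub>C y = (\<Sum>i<k. cinner (\<phi> i) (v - c *\<^sub>C y) *\<^sub>C \<phi> i)"
        by (rule \<phi>_span)
      also have "\<dots> = (\<Sum>i<k. cinner (\<phi> i) v *\<^sub>C \<phi> i)"
        by (intro sum.cong) (simp_all add: cinner_diff_right cinner_scaleC_right y_orth)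
      finally have v_eq: "v = (\<Sum>i<k. cinner (\<phi> i) v *\<^sub>C \<phi> i) + c *\<^sub>C y"
        by (simp add: algebra_simps)
      have "cinner y v = c"
        by (subst v_eq) (simp add: cinner_add_right cinner_sum_right cinner_scaleC_right y_orth y_norm)
      with v_eq show ?thesis
        by simp
    qed
    have y_C: "C y = complex_of_real (l k) *\<^sub>C y"
    proof -
      have q_Cy: "q j (C y) = (if j = k then complex_of_real (l k) * complex_of_real (1 / norm x) else 0)"
        if "j < n" "k \<le> j" for j
      proof -
        have "b j m * q m y = (if m = k then if j = k then b k k * complex_of_real (1 / norm x) else 0 else 0)"
          if "m < n" for m
        proof (cases "m < j")
          case True
          then show ?thesis
            using triangular[of m j] \<open>j < n\<close> \<open>k \<le> j\<close> by auto
        next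
          case False
          then show ?thesis
            using \<open>k \<le> j\<close> that by (auto simp: y_q)
        qed
        then have "q j (C y)
            = (\<Sum>m<n. if m = k then if j = k then b k k * complex_of_real (1 / norm x) else 0 else 0)"
          unfolding q_C[OF \<open>j < n\<close>] by (intro sum.cong) auto
        also have "\<dots> = (if j = k then b k k * complex_of_real (1 / norm x) else 0)"
          using k by (simp add: sum.delta)
        finally show ?thesis
          using diagonal[OF k] by simp
      qed
      have "cinner (\<phi> i) (C y) = 0" if "i < k" for i
        using that by (simp add: C_sym[symmetric] \<phi>_C cinner_scaleC_left y_orth)
      then have eq: "C y = cinner y (C y) *\<^sub>C y"
        using y_span[of "C y"] by (simp add: C_range q_Cy)
      have "q k (C y) = cinner y (C y) * complex_of_real (1 / norm x)"
        using k by (subst eq) (simp add: q_scale y_q)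
      then have "cinner y (C y) = complex_of_real (l k)"
        using k \<open>x \<noteq> 0\<close> by (simp add: q_Cy)
      with eq show ?thesis
        by simp
    qed
    have "basis (Suc k) (\<phi>(k := y))"
      unfolding basis_def
    proof (intro conjI allI impI)
      show "cinner ((\<phi>(k := y)) i) ((\<phi>(k := y)) j) = (if i = j then 1 else 0)"
        if "i < Suc k" "j < Suc k" for i j
        using that by (auto simp: less_Suc_eq \<phi>_orth y_orth y_norm)
      show "v = (\<Sum>i<Suc k. cinner ((\<phi>(k := y)) i) v *\<^sub>C (\<phi>(k := y)) i)"
        if "N v = v \<and> (\<forall>j<n. Suc k \<le> j \<longrightarrow> q j v = 0)" for v
        using y_span[of v] that by simp
    qed (auto simp: less_Suc_eq y_N y_C y_q \<phi>_N \<phi>_C \<phi>_q)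
    then show ?case
      by blast
  qed
  then obtain \<phi> where "basis n \<phi>"
    by blast
  then show ?thesis
    by (intro that[of \<phi>]) (auto simp: basis_def)
qed

lemma mat_mult_entry:
  assumes "A \<in> carrier_mat n n" "B \<in> carrier_mat n n" "i < n" "j < n"
  shows "(A * B) $$ (i, j) = (\<Sum>m<n. A $$ (i, m) * B $$ (m, j))"
  using assms by (simp add: scalar_prod_def atLeast0LessThan)

lemma prod_lessThan_conv_prod_list: "(\<Prod>k<n. f k) = prod_list (map f [0..<n])"
  for f :: "nat \<Rightarrow> 'b::comm_monoid_mult"
  by (induction n) (simp_all add: lessThan_Suc mult.commute)

lemma bounded_operator_basis_projection: "bounded_operator (basis_projection e n)"
  unfolding basis_projection_def[abs_def] by (intro bounded_operator_sum bounded_operator_rank_one)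

lemma basis_projection_cinner:
  "cinner (basis_projection e n u) v = cinner u (basis_projection e n v)"
proof -
  have "cnj (cinner (e k) u) = cinner u (e k)" for k
    by (metis cinner_commute)
  then show ?thesis
    by (simp add: basis_projection_def cinner_sum_left cinner_sum_right cinner_scaleC_left
        cinner_scaleC_right mult.commute)
qed

text \<open>Schur triangularisation realises the prescribed order of the roots on the diagonal, but through a
  similarity that need not be unitary; \<open>triangular_selfadjoint_eigenbasis\<close> makes the basis
  orthonormal and the matrix diagonal.\<close>

lemma truncation_eigenbasis:
  fixes e :: "nat \<Rightarrow> 'a::complex_hilbert_space"
  assumes orth: "\<And>i j. cinner (e i) (e j) = (if i = j then 1 else 0)"
    and T: "selfadjoint_operator T"
    and char_poly: "char_poly (truncation_matrix e T n) = (\<Prod>k<n. [:- complex_of_real (l k), 1:])"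
  obtains \<phi> :: "nat \<Rightarrow> 'a"
  where "\<And>i j. i < n \<Longrightarrow> j < n \<Longrightarrow> cinner (\<phi> i) (\<phi> j) = (if i = j then 1 else 0)"
    "\<And>j v. j < n \<Longrightarrow> cinner (\<phi> j) (T (basis_projection e n v)) = complex_of_real (l j) * cinner (\<phi> j) v"
    "\<And>v. basis_projection e n v = (\<Sum>j<n. cinner (\<phi> j) v *\<^sub>C \<phi> j)"
proof -
  define M where "M = truncation_matrix e T n"
  define N where "N = basis_projection e n"
  define C where "C v = N (T (N v))" for v
  define es where "es = map (\<lambda>k. complex_of_real (l k)) [0..<n]"
  have M: "M \<in> carrier_mat n n"
    by (simp add: M_def truncation_matrix_def)
  have M_poly: "char_poly M = (\<Prod>a\<leftarrow>es. [:- a, 1:])"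
    unfolding M_def char_poly es_def prod_lessThan_conv_prod_list by (simp add: o_def)
  obtain B P Q where "schur_decomposition M es = (B, P, Q)"
    using prod_cases3 by blast
  from schur_decomposition[OF M M_poly this]
  have wit: "similar_mat_wit M B P Q" and upper: "upper_triangular B" and diag: "diag_mat B = es"
    by auto
  from similar_mat_witD2[OF M wit]
  have mats: "B \<in> carrier_mat n n" "P \<in> carrier_mat n n" "Q \<in> carrier_mat n n"
    and PQ: "P * Q = 1\<^sub>m n" and QP: "Q * P = 1\<^sub>m n" and M_eq: "M = P * B * Q"
    by auto
  have "Q * M = Q * (P * (B * Q))"
    using mats by (simp add: M_eq)
  also have "\<dots> = (Q * P) * (B * Q)"
    using mats by (intro assoc_mult_mat[symmetric]) auto
  also have "\<dots> = B * Q"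
    using mats by (simp add: QP)
  finally have QM: "Q * M = B * Q" .
  have N: "bounded_operator N"
    unfolding N_def by (rule bounded_operator_basis_projection)
  have N_eq: "N v = (\<Sum>k<n. cinner (e k) v *\<^sub>C e k)" for v
    by (simp add: N_def basis_projection_def)
  have N_e: "N (e k) = e k" if "k < n" for k
  proof -
    have "N (e k) = (\<Sum>j<n. if j = k then e j else 0)"
      unfolding N_eq by (intro sum.cong) (auto simp: orth)
    with that show ?thesis
      by simp
  qed
  have N_N: "N (N v) = N v" for v
    unfolding N_eq[of v] by (simp add: bounded_operator_simps[OF N] N_e)
  have e_N: "cinner (e k) (N v) = cinner (e k) v" if "k < n" for k v
    using basis_projection_cinner[of e n "e k" v] N_e[OF that] by (simp add: N_def)
  have C: "bounded_operator C"
    unfolding C_def[abs_def]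
    by (rule bounded_operator_compose[OF N bounded_operator_compose[OF selfadjoint_bounded[OF T] N]])
  have e_C: "cinner (e i) (C v) = (\<Sum>j<n. M $$ (i, j) * cinner (e j) v)" if "i < n" for i v
  proof -
    have "C v = C (N v)"
      by (simp add: C_def N_N)
    also have "\<dots> = (\<Sum>j<n. cinner (e j) v *\<^sub>C C (e j))"
      unfolding N_eq by (simp add: bounded_operator_simps[OF C])
    finally show ?thesis
      using that by (simp add: cinner_sum_right cinner_scaleC_right M_def truncation_matrix_def C_def
          N_def mult.commute)
  qed
  \<comment> \<open>\<open>p k\<close> is the \<open>k\<close>-th column of \<open>P\<close> as a vector of the space; the \<open>q k\<close> are its dual functionals.\<close>
  define q where "q k v = (\<Sum>i<n. Q $$ (k, i) * cinner (e i) v)" for k v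
  define p where "p k = (\<Sum>i<n. P $$ (i, k) *\<^sub>C e i)" for k
  have e_p: "cinner (e i) (p k) = P $$ (i, k)" if "i < n" for i k
  proof -
    have "cinner (e i) (p k) = (\<Sum>j<n. P $$ (j, k) * cinner (e i) (e j))"
      by (simp add: p_def cinner_sum_right cinner_scaleC_right)
    also have "\<dots> = (\<Sum>j<n. if j = i then P $$ (j, k) else 0)"
      by (intro sum.cong) (auto simp: orth)
    finally have "cinner (e i) (p k) = (\<Sum>j<n. if j = i then P $$ (j, k) else 0)" .
    with that show ?thesis
      by simp
  qed
  have q_C: "q k (C v) = (\<Sum>j<n. B $$ (k, j) * q j v)" if k: "k < n" for k v
  proof -
    have "q k (C v) = (\<Sum>i<n. \<Sum>j<n. Q $$ (k, i) * (M $$ (i, j) * cinner (e j) v))"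
      by (simp add: q_def e_C sum_distrib_left)
    also have "\<dots> = (\<Sum>j<n. (Q * M) $$ (k, j) * cinner (e j) v)"
      using k by (subst sum.swap) (simp add: mat_mult_entry[OF mats(3) M] sum_distrib_right mult.assoc)
    also have "\<dots> = (\<Sum>j<n. \<Sum>i<n. B $$ (k, i) * (Q $$ (i, j) * cinner (e j) v))"
      using k by (simp add: QM mat_mult_entry[OF mats(1,3)] sum_distrib_right mult.assoc)
    also have "\<dots> = (\<Sum>i<n. B $$ (k, i) * q i v)"
      by (subst sum.swap) (simp add: q_def sum_distrib_left)
    finally show ?thesis .
  qed
  have coords: "cinner (e i) v = (\<Sum>k<n. P $$ (i, k) * q k v)" if i: "i < n" for i v
  proof -
    have "(\<Sum>k<n. P $$ (i, k) * q k v) = (\<Sum>j<n. (P * Q) $$ (i, j) * cinner (e j) v)"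
      using i unfolding q_def sum_distrib_left
      by (subst sum.swap) (simp add: mat_mult_entry[OF mats(2,3)] sum_distrib_right mult.assoc)
    also have "\<dots> = (\<Sum>j<n. if j = i then cinner (e j) v else 0)"
      using i by (intro sum.cong) (auto simp: PQ)
    finally show ?thesis
      using i by simp
  qed
  have diagonal: "B $$ (k, k) = complex_of_real (l k)" if "k < n" for k
    using arg_cong[OF diag, of "\<lambda>xs. xs ! k"] that mats(1) by (simp add: diag_mat_def es_def)
  obtain \<phi> where \<phi>: "\<And>i. i < n \<Longrightarrow> N (\<phi> i) = \<phi> i"
    "\<And>i. i < n \<Longrightarrow> C (\<phi> i) = complex_of_real (l i) *\<^sub>C \<phi> i"
    "\<And>i j. i < n \<Longrightarrow> j < n \<Longrightarrow> cinner (\<phi> i) (\<phi> j) = (if i = j then 1 else 0)"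
    "\<And>v. N v = v \<Longrightarrow> v = (\<Sum>i<n. cinner (\<phi> i) v *\<^sub>C \<phi> i)"
  proof (rule triangular_selfadjoint_eigenbasis[of N C q n "\<lambda>k j. B $$ (k, j)" l p])
    show "N (C v) = C v" for v
      by (simp add: C_def N_N)
    show "cinner (C u) v = cinner u (C v)" for u v
      by (simp add: C_def N_def basis_projection_cinner selfadjoint_cinner[OF T])
    show "q k (u + v) = q k u + q k v" "q k (c *\<^sub>C v) = c * q k v" for k u v c
      by (simp_all add: q_def cinner_add_right cinner_scaleC_right sum.distrib sum_distrib_left
          algebra_simps)
    show "N (p k) = p k" for k
      by (simp add: p_def bounded_operator_simps[OF N] N_e)
    show "q j (p k) = (if j = k then 1 else 0)" if "j < n" "k < n" for j k
      using that mat_mult_entry[OF mats(3,2) that] by (simp add: q_def e_p QP)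
    show "v = 0" if "N v = v" "\<And>k. k < n \<Longrightarrow> q k v = 0" for v
      using that by (simp add: N_eq[of v] coords)
    show "B $$ (k, j) = 0" if "j < k" "k < n" for k j
      using upper_triangularD[OF upper that(1)] that(2) mats(1) by simp
  qed (use N q_C diagonal in auto)
  have \<phi>_N: "cinner (\<phi> j) (N v) = cinner (\<phi> j) v" if "j < n" for j v
    using basis_projection_cinner[of e n "\<phi> j" v] \<phi>(1)[OF that] by (simp add: N_def)
  show ?thesis
  proof (rule that[of \<phi>])
    show "cinner (\<phi> j) (T (basis_projection e n v)) = complex_of_real (l j) * cinner (\<phi> j) v"
      if "j < n" for j v
    proof -
      have "cinner (\<phi> j) (T (N v)) = cinner (C (\<phi> j)) v"
        using \<phi>(1)[OF that] unfolding C_def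
        by (metis N_def basis_projection_cinner selfadjoint_cinner[OF T])
      then show ?thesis
        by (simp add: \<phi>(2)[OF that] cinner_scaleC_left N_def)
    qed
    show "basis_projection e n v = (\<Sum>j<n. cinner (\<phi> j) v *\<^sub>C \<phi> j)" for v
      using \<phi>(4)[of "N v"] by (simp add: N_N \<phi>_N flip: N_def)
  qed (rule \<phi>(3))
qed

section \<open>Essential spectrum attracts eigenvalues of truncations\<close>

text \<open>Bessel's inequality, with the constant degraded by the distance of the Gram matrix to the
  identity.\<close>

lemma almost_orthonormal_bessel:
  fixes u :: "nat \<Rightarrow> 'a::complex_hilbert_space"
  assumes unit: "\<And>i. i < N \<Longrightarrow> norm (u i) = 1"
    and almost: "\<And>i j. i < j \<Longrightarrow> j < N \<Longrightarrow> cmod (cinner (u i) (u j)) \<le> \<eta>" and \<eta>: "0 \<le> \<eta>"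
  shows "(\<Sum>i<N. (cmod (cinner (u i) x))\<^sup>2) \<le> (1 + real N * \<eta>) * (norm x)\<^sup>2"
proof -
  define c where "c i = cinner (u i) x" for i
  define z where "z = (\<Sum>i<N. c i *\<^sub>C u i)"
  define S where "S = (\<Sum>i<N. (cmod (c i))\<^sup>2)"
  have S_nonneg: "0 \<le> S"
    unfolding S_def by (intro sum_nonneg) auto
  have "cnj (c i) * c i = complex_of_real ((cmod (c i))\<^sup>2)" for i
    by (metis complex_norm_square mult.commute)
  then have "cinner z x = complex_of_real S"
    by (simp add: z_def S_def cinner_sum_left cinner_scaleC_left flip: c_def)
  then have "S \<le> norm z * norm x"
    using cauchy_schwarz[of z x] S_nonneg by simp
  then have "S\<^sup>2 \<le> (norm z * norm x)\<^sup>2"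
    using S_nonneg by (intro power_mono)
  have gram: "cmod (cinner (u i) (u j)) \<le> (if i = j then 1 else 0) + \<eta>" if "i < N" "j < N" for i j
  proof (cases i j rule: linorder_cases)
    case equal
    then show ?thesis
      using that unit \<eta> by (simp add: cinner_self)
  next
    case greater
    have "cmod (cinner (u i) (u j)) = cmod (cinner (u j) (u i))"
      by (subst cinner_commute) simp
    with greater show ?thesis
      using almost[of j i] that by simp
  qed (use almost that in simp)
  have z_left: "cinner z y = (\<Sum>i<N. cnj (c i) * cinner (u i) y)"
    and z_right: "cinner y z = (\<Sum>j<N. c j * cinner y (u j))" for y
    by (simp_all add: z_def cinner_sum_left cinner_sum_right cinner_scaleC_left cinner_scaleC_right)
  have "cinner z z = (\<Sum>i<N. \<Sum>j<N. cnj (c i) * (c j * cinner (u i) (u j)))"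
    by (subst z_left) (simp only: z_right sum_distrib_left)
  then have "(norm z)\<^sup>2 = Re (\<Sum>i<N. \<Sum>j<N. cnj (c i) * (c j * cinner (u i) (u j)))"
    by (simp only: Re_cinner_self[symmetric])
  also have "\<dots> \<le> (\<Sum>i<N. \<Sum>j<N. ((cmod (c i))\<^sup>2 + (cmod (c j))\<^sup>2) / 2 * ((if i = j then 1 else 0) + \<eta>))"
    unfolding Re_sum
  proof (intro sum_mono)
    fix i j
    assume ij: "i \<in> {..<N}" "j \<in> {..<N}"
    have "Re (cnj (c i) * (c j * cinner (u i) (u j))) \<le> cmod (c i) * cmod (c j) * cmod (cinner (u i) (u j))"
      using complex_Re_le_cmod[of "cnj (c i) * (c j * cinner (u i) (u j))"] by (simp add: norm_mult mult.assoc)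
    also have "\<dots> \<le> ((cmod (c i))\<^sup>2 + (cmod (c j))\<^sup>2) / 2 * ((if i = j then 1 else 0) + \<eta>)"
    proof (rule mult_mono)
      show "cmod (c i) * cmod (c j) \<le> ((cmod (c i))\<^sup>2 + (cmod (c j))\<^sup>2) / 2"
        using sum_squares_bound[of "cmod (c i)" "cmod (c j)"] by simp
    qed (use gram ij in auto)
    finally show "Re (cnj (c i) * (c j * cinner (u i) (u j)))
        \<le> ((cmod (c i))\<^sup>2 + (cmod (c j))\<^sup>2) / 2 * ((if i = j then 1 else 0) + \<eta>)" .
  qed
  also have "\<dots> = (\<Sum>i<N. (cmod (c i))\<^sup>2 + \<eta> / 2 * (real N * (cmod (c i))\<^sup>2 + S))"
  proof (rule sum.cong[OF refl])
    fix i
    assume "i \<in> {..<N}"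
    have "((cmod (c i))\<^sup>2 + (cmod (c j))\<^sup>2) / 2 * ((if i = j then 1 else 0) + \<eta>)
        = (if j = i then (cmod (c i))\<^sup>2 else 0) + \<eta> / 2 * ((cmod (c i))\<^sup>2 + (cmod (c j))\<^sup>2)" for j
      by (simp add: algebra_simps)
    then have "(\<Sum>j<N. ((cmod (c i))\<^sup>2 + (cmod (c j))\<^sup>2) / 2 * ((if i = j then 1 else 0) + \<eta>))
        = (\<Sum>j<N. if j = i then (cmod (c i))\<^sup>2 else 0)
          + \<eta> / 2 * (\<Sum>j<N. (cmod (c i))\<^sup>2 + (cmod (c j))\<^sup>2)"
      by (simp only: sum.distrib sum_distrib_left[symmetric])
    also have "\<dots> = (cmod (c i))\<^sup>2 + \<eta> / 2 * (real N * (cmod (c i))\<^sup>2 + S)"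
      using \<open>i \<in> {..<N}\<close> by (simp add: sum.distrib S_def)
    finally show "(\<Sum>j<N. ((cmod (c i))\<^sup>2 + (cmod (c j))\<^sup>2) / 2 * ((if i = j then 1 else 0) + \<eta>))
        = (cmod (c i))\<^sup>2 + \<eta> / 2 * (real N * (cmod (c i))\<^sup>2 + S)" .
  qed
  also have "\<dots> = S + \<eta> / 2 * (real N * S + real N * S)"
    by (simp only: sum.distrib sum_distrib_left[symmetric] S_def sum_constant card_lessThan)
  finally have z_norm: "(norm z)\<^sup>2 \<le> (1 + real N * \<eta>) * S"
    by (simp add: algebra_simps)
  have "S * S \<le> (norm z)\<^sup>2 * (norm x)\<^sup>2"
    using \<open>S\<^sup>2 \<le> (norm z * norm x)\<^sup>2\<close> by (simp add: power_mult_distrib power2_eq_square[of S])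
  also have "\<dots> \<le> (1 + real N * \<eta>) * S * (norm x)\<^sup>2"
    using z_norm by (intro mult_right_mono) auto
  finally have "S * S \<le> S * ((1 + real N * \<eta>) * (norm x)\<^sup>2)"
    by (simp add: mult_ac)
  then have "S \<le> (1 + real N * \<eta>) * (norm x)\<^sup>2"
    using S_nonneg \<eta> by (cases "S = 0") auto
  then show ?thesis
    by (simp add: S_def c_def)
qed

lemma bessel:
  fixes u :: "nat \<Rightarrow> 'a::complex_hilbert_space"
  assumes "\<And>i j. i < N \<Longrightarrow> j < N \<Longrightarrow> cinner (u i) (u j) = (if i = j then 1 else 0)"
  shows "(\<Sum>i<N. (cmod (cinner (u i) x))\<^sup>2) \<le> (norm x)\<^sup>2"
proof -
  have "norm (u i) = 1" if "i < N" for i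
    using assms[OF that that] cinner_self[of "u i"] by (metis of_real_eq_1_iff norm_ge_zero power2_eq_1_iff
        neg_0_le_iff_le not_one_le_zero)
  then show ?thesis
    using almost_orthonormal_bessel[of N u 0 x] assms by simp
qed

lemma norm_sq_orthonormal_sum:
  fixes u :: "nat \<Rightarrow> 'a::complex_hilbert_space"
  assumes "\<And>i j. i < N \<Longrightarrow> j < N \<Longrightarrow> cinner (u i) (u j) = (if i = j then 1 else 0)"
  shows "(norm (\<Sum>i<N. c i *\<^sub>C u i))\<^sup>2 = (\<Sum>i<N. (cmod (c i))\<^sup>2)"
proof -
  have right: "cinner (u i) (\<Sum>j<N. c j *\<^sub>C u j) = c i" if "i < N" for i
  proof -
    have "cinner (u i) (\<Sum>j<N. c j *\<^sub>C u j) = (\<Sum>j<N. c j * cinner (u i) (u j))"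
      by (simp add: cinner_sum_right cinner_scaleC_right)
    also have "\<dots> = (\<Sum>j<N. if j = i then c j else 0)"
      using that by (intro sum.cong) (auto simp: assms)
    finally show ?thesis
      using that by simp
  qed
  have "cinner (\<Sum>i<N. c i *\<^sub>C u i) (\<Sum>i<N. c i *\<^sub>C u i)
      = (\<Sum>i<N. cnj (c i) * cinner (u i) (\<Sum>j<N. c j *\<^sub>C u j))"
    by (subst cinner_sum_left) (simp only: cinner_scaleC_left)
  also have "\<dots> = (\<Sum>i<N. cnj (c i) * c i)"
    by (simp add: right)
  also have "\<dots> = complex_of_real (\<Sum>i<N. (cmod (c i))\<^sup>2)"
    by (simp add: complex_norm_square mult.commute del: of_real_power)
  finally show ?thesis
    using cinner_self of_real_eq_iff by metis
qed

text \<open>The projections are contractions and eventually fix every vector of the dense span.\<close>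

lemma basis_projection_tendsto:
  fixes e :: "nat \<Rightarrow> 'a::complex_hilbert_space"
  assumes basis: "orthonormal_basis e"
  shows "(\<lambda>n. basis_projection e n v) \<longlonglongrightarrow> v"
proof (rule LIMSEQ_I)
  fix \<epsilon> :: real
  assume \<epsilon>: "0 < \<epsilon>"
  interpret complex: vector_space "scaleC :: complex \<Rightarrow> 'a \<Rightarrow> 'a"
    by (rule vector_space_scaleC)
  have orth: "cinner (e i) (e j) = (if i = j then 1 else 0)" for i j
    using basis by (simp add: orthonormal_basis_def)
  define N where "N n = basis_projection e n" for n
  have N: "bounded_operator (N n)" for n
    unfolding N_def by (rule bounded_operator_basis_projection)
  have contraction: "norm (N n x) \<le> norm x" for n x
  proof -
    have "(norm (N n x))\<^sup>2 \<le> (norm x)\<^sup>2"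
      using bessel[of n e x] by (simp add: N_def basis_projection_def norm_sq_orthonormal_sum orth)
    then show ?thesis
      by (rule power2_le_imp_le) simp
  qed
  have eventually_fixed: "\<forall>\<^sub>F n in sequentially. N n s = s" if "s \<in> complex.span (range e)" for s
    using that
  proof (induction rule: complex.span_induct)
    show "complex.subspace {s. \<forall>\<^sub>F n in sequentially. N n s = s}"
      unfolding complex.subspace_def
      by (auto simp: bounded_operator_simps[OF N] elim: eventually_elim2 eventually_mono)
  next
    fix s
    assume "s \<in> range e"
    then obtain k where s: "s = e k"
      by blast
    have "N n (e k) = e k" if "k < n" for n
    proof -
      have "N n (e k) = (\<Sum>j<n. if j = k then e j else 0)"
        unfolding N_def basis_projection_def by (intro sum.cong) (auto simp: orth)
      with that show ?thesis
        by simp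
    qed
    then show "\<forall>\<^sub>F n in sequentially. N n s = s"
      using eventually_gt_at_top[of k] unfolding s by (rule eventually_mono[rotated])
  qed
  have "v \<in> closure (complex.span (range e))"
    using basis by (simp add: orthonormal_basis_def)
  then obtain s where s: "s \<in> complex.span (range e)" "dist s v < \<epsilon> / 2"
    using \<epsilon> unfolding closure_approachable by (metis half_gt_zero)
  obtain n0 where n0: "\<And>n. n0 \<le> n \<Longrightarrow> N n s = s"
    using eventually_fixed[OF s(1)] by (auto simp: eventually_sequentially)
  have "norm (N n v - v) < \<epsilon>" if "n0 \<le> n" for n
  proof -
    have eq: "N n v - v = N n (v - s) + (s - v)"
      using n0[OF that] by (simp add: bounded_operator_simps[OF N])
    have "norm (N n v - v) \<le> norm (N n (v - s)) + norm (s - v)"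
      unfolding eq by (rule norm_triangle_ineq)
    also have "\<dots> \<le> norm (v - s) + norm (s - v)"
      using contraction by simp
    finally show ?thesis
      using s(2)
      by (simp add: dist_norm norm_minus_commute)
  qed
  then show "\<exists>n0. \<forall>n\<ge>n0. norm (basis_projection e n v - v) < \<epsilon>"
    unfolding N_def by blast
qed

text \<open>Essential singularity at \<open>t\<close> provides \<open>N\<close> almost orthonormal vectors that \<open>T - t\<close> shrinks below
  \<open>\<rho> / 4\<close>. For large \<open>n\<close> the projections of these vectors to the first \<open>n\<close> basis vectors are shrunk
  below \<open>\<rho> / 2\<close>, so each of them has at least half of its mass on eigenvectors of the truncation
  with eigenvalue in \<open>(t - \<rho>, t + \<rho>)\<close>. By the almost orthonormal Bessel inequality one eigenvector
  carries a total mass of at most \<open>2\<close> from all \<open>N\<close> vectors, so that at least \<open>N / 4\<close> eigenvectors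
  are needed.\<close>

lemma essentially_singular_crowding:
  fixes e :: "nat \<Rightarrow> 'a::complex_hilbert_space" and t \<rho> :: real
  assumes basis: "orthonormal_basis e" and T: "selfadjoint_operator T"
    and eigen: "\<And>n. 1 \<le> n \<Longrightarrow>
      char_poly (truncation_matrix e T n) = (\<Prod>k<n. [:- complex_of_real (l n k), 1:])"
    and \<rho>: "0 < \<rho>" and sing: "essentially_singular T (complex_of_real t) (\<rho> / 4)"
  shows "\<forall>\<^sub>F n in sequentially. real N \<le> 4 * real (card {j. j < n \<and> \<bar>l n j - t\<bar> < \<rho>})"
proof (cases "N = 0")
  case False
  have orth: "cinner (e i) (e j) = (if i = j then 1 else 0)" for i j
    using basis by (simp add: orthonormal_basis_def)
  define R where "R v = T v - complex_of_real t *\<^sub>C v" for v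
  have R: "bounded_operator R"
    unfolding R_def[abs_def] by (rule bounded_operator_shift[OF selfadjoint_bounded[OF T]])
  have "\<exists>u::nat \<Rightarrow> 'a. (\<forall>k. norm (u k) = 1 \<and> norm (R (u k)) < \<rho> / 4) \<and>
      (\<forall>i k. i < k \<longrightarrow> cmod (cinner (u i) (u k)) < 1 / real N)"
    unfolding R_def by (rule almost_orthonormal_sequence[OF sing]) (use False in simp)
  then obtain u :: "nat \<Rightarrow> 'a" where u: "\<And>k. norm (u k) = 1" "\<And>k. norm (R (u k)) < \<rho> / 4"
    "\<And>i k. i < k \<Longrightarrow> cmod (cinner (u i) (u k)) < 1 / real N"
    by blast
  have "\<forall>\<^sub>F n in sequentially. norm (R (basis_projection e n (u i))) < \<rho> / 2
      \<and> 3 / 4 < (norm (basis_projection e n (u i)))\<^sup>2" for i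
  proof (rule eventually_conj)
    have "(\<lambda>n. norm (R (basis_projection e n (u i)))) \<longlonglongrightarrow> norm (R (u i))"
      by (intro tendsto_norm bounded_linear.tendsto[OF bounded_operator_linear[OF R]]
          basis_projection_tendsto[OF basis])
    moreover have "norm (R (u i)) < \<rho> / 2"
      using u(2)[of i] \<rho> by simp
    ultimately show "\<forall>\<^sub>F n in sequentially. norm (R (basis_projection e n (u i))) < \<rho> / 2"
      by (rule order_tendstoD)
    have "(\<lambda>n. (norm (basis_projection e n (u i)))\<^sup>2) \<longlonglongrightarrow> (norm (u i))\<^sup>2"
      by (intro tendsto_intros basis_projection_tendsto[OF basis])
    then show "\<forall>\<^sub>F n in sequentially. 3 / 4 < (norm (basis_projection e n (u i)))\<^sup>2"
      by (rule order_tendstoD) (simp add: u(1))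
  qed
  then have "\<forall>\<^sub>F n in sequentially. \<forall>i\<in>{..<N}. norm (R (basis_projection e n (u i))) < \<rho> / 2
      \<and> 3 / 4 < (norm (basis_projection e n (u i)))\<^sup>2"
    by (intro eventually_ball_finite) auto
  moreover have "\<forall>\<^sub>F n in sequentially. 1 \<le> n"
    by (rule eventually_ge_at_top)
  ultimately show ?thesis
  proof eventually_elim
    case (elim n)
    define J where "J = {j. j < n \<and> \<bar>l n j - t\<bar> < \<rho>}"
    have J: "J \<subseteq> {..<n}" "finite J"
      by (auto simp: J_def)
    obtain \<phi> where \<phi>: "\<And>i j. i < n \<Longrightarrow> j < n \<Longrightarrow> cinner (\<phi> i) (\<phi> j) = (if i = j then 1 else 0)"
      "\<And>j v. j < n \<Longrightarrow> cinner (\<phi> j) (T (basis_projection e n v))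
        = complex_of_real (l n j) * cinner (\<phi> j) v"
      "\<And>v. basis_projection e n v = (\<Sum>j<n. cinner (\<phi> j) v *\<^sub>C \<phi> j)"
      using truncation_eigenbasis[OF orth T eigen[OF elim(2)]] by blast
    have inside: "1 / 2 \<le> (\<Sum>j\<in>J. (cmod (cinner (u i) (\<phi> j)))\<^sup>2)" if "i < N" for i
    proof -
      define v where "v = basis_projection e n (u i)"
      have v: "norm (R v) < \<rho> / 2" "3 / 4 < (norm v)\<^sup>2"
        using elim(1) that by (auto simp: v_def)
      have total: "(norm v)\<^sup>2 = (\<Sum>j<n. (cmod (cinner (\<phi> j) (u i)))\<^sup>2)"
        unfolding v_def \<phi>(3) by (rule norm_sq_orthonormal_sum[OF \<phi>(1)])
      have \<phi>_v: "cinner (\<phi> j) v = cinner (\<phi> j) (u i)" if "j < n" for j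
      proof -
        have "cinner (\<phi> j) v = (\<Sum>k<n. cinner (\<phi> k) (u i) * cinner (\<phi> j) (\<phi> k))"
          by (simp add: v_def \<phi>(3) cinner_sum_right cinner_scaleC_right)
        also have "\<dots> = (\<Sum>k<n. if k = j then cinner (\<phi> k) (u i) else 0)"
          using that by (intro sum.cong) (auto simp: \<phi>(1))
        finally show ?thesis
          using that by simp
      qed
      have \<phi>_R: "cmod (cinner (\<phi> j) (R v)) = \<bar>l n j - t\<bar> * cmod (cinner (\<phi> j) (u i))" if "j < n" for j
      proof -
        have "cinner (\<phi> j) (R v) = complex_of_real (l n j - t) * cinner (\<phi> j) (u i)"
          using \<phi>(2)[OF that, of "u i"] \<phi>_v[OF that]
          by (simp add: R_def cinner_diff_right cinner_scaleC_right v_def left_diff_distrib)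
        then show ?thesis
          by (simp only: norm_mult norm_of_real real_norm_def)
      qed
      have "\<rho>\<^sup>2 * (\<Sum>j\<in>{..<n} - J. (cmod (cinner (\<phi> j) (u i)))\<^sup>2)
          \<le> (\<Sum>j\<in>{..<n} - J. (cmod (cinner (\<phi> j) (R v)))\<^sup>2)"
        unfolding sum_distrib_left
      proof (rule sum_mono)
        fix j
        assume "j \<in> {..<n} - J"
        then have j: "j < n" "\<rho> \<le> \<bar>l n j - t\<bar>"
          by (auto simp: J_def)
        show "\<rho>\<^sup>2 * (cmod (cinner (\<phi> j) (u i)))\<^sup>2 \<le> (cmod (cinner (\<phi> j) (R v)))\<^sup>2"
          unfolding \<phi>_R[OF j(1)] power_mult_distrib
          using j(2) \<rho> by (intro mult_right_mono power_mono) auto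
      qed
      also have "\<dots> \<le> (\<Sum>j<n. (cmod (cinner (\<phi> j) (R v)))\<^sup>2)"
        by (intro sum_mono2) auto
      also have "\<dots> \<le> (norm (R v))\<^sup>2"
        by (rule bessel[OF \<phi>(1)])
      also have "\<dots> \<le> (\<rho> / 2)\<^sup>2"
        using v(1) by (intro power_mono) auto
      finally have "(\<Sum>j\<in>{..<n} - J. (cmod (cinner (\<phi> j) (u i)))\<^sup>2) \<le> 1 / 4"
        using \<rho> by (simp add: power_divide field_simps)
      moreover have "(\<Sum>j<n. (cmod (cinner (\<phi> j) (u i)))\<^sup>2)
          = (\<Sum>j\<in>{..<n} - J. (cmod (cinner (\<phi> j) (u i)))\<^sup>2) + (\<Sum>j\<in>J. (cmod (cinner (\<phi> j) (u i)))\<^sup>2)"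
        using J by (intro sum.subset_diff) auto
      ultimately have "1 / 2 \<le> (\<Sum>j\<in>J. (cmod (cinner (\<phi> j) (u i)))\<^sup>2)"
        using v(2) total by linarith
      moreover have "cmod (cinner (\<phi> j) (u i)) = cmod (cinner (u i) (\<phi> j))" for j
        by (subst cinner_commute) simp
      ultimately show ?thesis
        by simp
    qed
    have outside: "(\<Sum>i<N. (cmod (cinner (u i) (\<phi> j)))\<^sup>2) \<le> 2" if "j \<in> J" for j
    proof -
      have "cinner (\<phi> j) (\<phi> j) = 1"
        using \<phi>(1)[of j j] that by (auto simp: J_def)
      then have "(norm (\<phi> j))\<^sup>2 = 1"
        using Re_cinner_self[of "\<phi> j"] by simp
      then show ?thesis
        using almost_orthonormal_bessel[of N u "1 / real N" "\<phi> j"] u False by (auto simp: less_imp_le)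
    qed
    have "real N / 2 = (\<Sum>i<N. 1 / 2 :: real)"
      by simp
    also have "\<dots> \<le> (\<Sum>i<N. \<Sum>j\<in>J. (cmod (cinner (u i) (\<phi> j)))\<^sup>2)"
      using inside by (intro sum_mono) auto
    also have "\<dots> = (\<Sum>j\<in>J. \<Sum>i<N. (cmod (cinner (u i) (\<phi> j)))\<^sup>2)"
      by (rule sum.swap)
    also have "\<dots> \<le> (\<Sum>j\<in>J. 2)"
      using outside by (rule sum_mono)
    finally show ?case
      by (simp add: J_def)
  qed
qed simp

section \<open>Gaps and perturbations\<close>

lemma truncation_eigenvalue_numerical_value:
  fixes e :: "nat \<Rightarrow> 'a::complex_hilbert_space"
  assumes basis: "orthonormal_basis e" and T: "selfadjoint_operator T"
    and char_poly: "char_poly (truncation_matrix e T n) = (\<Prod>k<n. [:- complex_of_real (l k), 1:])"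
    and k: "k < n"
  obtains v where "norm v = 1" "Re (cinner v (T v)) = l k"
proof -
  have orth: "cinner (e i) (e j) = (if i = j then 1 else 0)" for i j
    using basis by (simp add: orthonormal_basis_def)
  obtain \<phi> where \<phi>: "\<And>i j. i < n \<Longrightarrow> j < n \<Longrightarrow> cinner (\<phi> i) (\<phi> j) = (if i = j then 1 else 0)"
    "\<And>j v. j < n \<Longrightarrow> cinner (\<phi> j) (T (basis_projection e n v)) = complex_of_real (l j) * cinner (\<phi> j) v"
    "\<And>v. basis_projection e n v = (\<Sum>j<n. cinner (\<phi> j) v *\<^sub>C \<phi> j)"
    using truncation_eigenbasis[OF orth T char_poly] by blast
  have "basis_projection e n (\<phi> k) = (\<Sum>j<n. if j = k then \<phi> j else 0)"
    unfolding \<phi>(3) using k by (intro sum.cong) (auto simp: \<phi>(1))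
  with k have "basis_projection e n (\<phi> k) = \<phi> k"
    by simp
  moreover have self: "cinner (\<phi> k) (\<phi> k) = 1"
    using \<phi>(1)[OF k k] by simp
  ultimately have "cinner (\<phi> k) (T (\<phi> k)) = complex_of_real (l k)"
    using \<phi>(2)[OF k, of "\<phi> k"] by simp
  moreover have "norm (\<phi> k) = 1"
    using Re_cinner_self[of "\<phi> k"] self by (simp add: power2_eq_1_iff)
      (use norm_ge_zero[of "\<phi> k"] in linarith)
  ultimately show ?thesis
    by (intro that[of "\<phi> k"]) auto
qed

lemma weighted_mean_bounds:
  fixes w x :: "nat \<Rightarrow> real"
  assumes "\<And>k. k < n \<Longrightarrow> 0 \<le> w k" "(\<Sum>k<n. w k) = 1"
    and "\<And>k. k < n \<Longrightarrow> a \<le> x k" "\<And>k. k < n \<Longrightarrow> x k \<le> b"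
  shows "a \<le> (\<Sum>k<n. w k * x k)" "(\<Sum>k<n. w k * x k) \<le> b"
proof -
  have "(\<Sum>k<n. w k * a) \<le> (\<Sum>k<n. w k * x k)" "(\<Sum>k<n. w k * x k) \<le> (\<Sum>k<n. w k * b)"
    using assms by (auto intro!: sum_mono mult_left_mono)
  with assms(2) show "a \<le> (\<Sum>k<n. w k * x k)" "(\<Sum>k<n. w k * x k) \<le> b"
    by (simp_all flip: sum_distrib_right)
qed

text \<open>Finiteness of the limit of the quotients makes the family Lipschitz at \<open>y\<close>.\<close>

lemma holomorphic_family_continuous:
  assumes holo: "holomorphic_family D A" and D: "open D" "y \<in> D" and \<eta>: "0 < \<eta>"
  obtains r where "0 < r" "ball y r \<subseteq> D"
    "\<And>x v. x \<in> ball y r \<Longrightarrow> norm (A x v - A y v) \<le> \<eta> * norm v"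
proof -
  obtain L where "((\<lambda>x. onorm (\<lambda>v. A x v - A y v) / cmod (x - y)) \<longlongrightarrow> L) (at y within D)"
    using holo D(2) by (auto simp: holomorphic_family_def)
  then have "\<forall>\<^sub>F x in at y within D. onorm (\<lambda>v. A x v - A y v) / cmod (x - y) < \<bar>L\<bar> + 1"
    by (rule order_tendstoD) simp
  then obtain d where d: "0 < d"
    "\<And>x. x \<in> D \<Longrightarrow> x \<noteq> y \<Longrightarrow> dist x y < d \<Longrightarrow> onorm (\<lambda>v. A x v - A y v) / cmod (x - y) < \<bar>L\<bar> + 1"
    unfolding eventually_at by blast
  obtain r0 where r0: "0 < r0" "ball y r0 \<subseteq> D"
    using D open_contains_ball by blast
  define r where "r = min r0 (min d (\<eta> / (\<bar>L\<bar> + 1)))"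
  show ?thesis
  proof (rule that[of r])
    show "0 < r"
      using r0 d \<eta> by (simp add: r_def)
    show sub: "ball y r \<subseteq> D"
      using r0(2) by (auto simp: r_def)
    fix x v
    assume x: "x \<in> ball y r"
    show "norm (A x v - A y v) \<le> \<eta> * norm v"
    proof (cases "x = y")
      case False
      have "x \<in> D"
        using x sub by blast
      have near: "dist x y < d" "cmod (x - y) < \<eta> / (\<bar>L\<bar> + 1)"
        using x by (auto simp: r_def dist_norm norm_minus_commute)
      have "onorm (\<lambda>v. A x v - A y v) < (\<bar>L\<bar> + 1) * cmod (x - y)"
        using d(2)[OF \<open>x \<in> D\<close> False near(1)] False by (simp add: divide_less_eq)
      also have "\<dots> < \<eta>"
        using near(2) by (simp add: pos_less_divide_eq add_nonneg_pos mult.commute)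
      finally have small: "onorm (\<lambda>v. A x v - A y v) < \<eta>" .
      have "bounded_linear (\<lambda>v. A x v - A y v)"
        using holo D(2) \<open>x \<in> D\<close>
        by (intro bounded_operator_linear bounded_operator_diff) (auto simp: holomorphic_family_def)
      from onorm[OF this, of v] show ?thesis
        using mult_right_mono[OF less_imp_le[OF small] norm_ge_zero[of v]] by linarith
    qed (use \<eta> in simp)
  qed
qed

lemma has_gap_around:
  assumes T: "selfadjoint_operator T" and \<delta>: "0 < \<delta>"
    and low: "complex_of_real t1 \<in> essential_spectrum T" "t1 \<le> c - \<delta>"
    and high: "complex_of_real t2 \<in> essential_spectrum T" "c + \<delta> \<le> t2"
    and gap: "\<And>s. \<bar>s - c\<bar> < \<delta> \<Longrightarrow> complex_of_real s \<notin> essential_spectrum T"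
  shows "has_gap (essential_spectrum T)"
proof -
  obtain B where B: "\<And>v. norm (T v) \<le> B * norm v"
    using bounded_operator_bound[OF selfadjoint_bounded[OF T]] by blast
  have "\<bar>x\<bar> \<le> B" if "x \<in> Re ` essential_spectrum T" for x
    using that essential_spectrum_norm_le[OF T B] abs_Re_le_cmod order_trans by blast
  then have bdd: "bdd_below (Re ` essential_spectrum T)" "bdd_above (Re ` essential_spectrum T)"
    by (force intro!: bdd_belowI[of _ "- B"] bdd_aboveI[of _ B])+
  have "t1 \<in> Re ` essential_spectrum T" "t2 \<in> Re ` essential_spectrum T"
    using low(1) high(1) by force+
  then have "Inf (Re ` essential_spectrum T) \<le> c - \<delta>" "c + \<delta> \<le> Sup (Re ` essential_spectrum T)"
    using cInf_lower[OF _ bdd(1)] cSup_upper[OF _ bdd(2)] low(2) high(2) order_trans by blast+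
  moreover have "\<forall>s\<in>{c - \<delta><..<c + \<delta>}. complex_of_real s \<notin> essential_spectrum T"
    using gap by (auto simp: abs_less_iff)
  moreover have "c - \<delta> < c + \<delta>"
    using \<delta> by simp
  ultimately show ?thesis
    unfolding has_gap_def by blast
qed

theorem corollary2:
  fixes e :: "nat \<Rightarrow> 'a::complex_hilbert_space"
    and A :: "complex \<Rightarrow> 'a \<Rightarrow> 'a"
    and D0 :: "complex set"
    and lam w :: "nat \<Rightarrow> nat \<Rightarrow> real"
  assumes basis: "orthonormal_basis e"
    and domain: "open D0" "connected D0" "0 \<in> D0"
    and holo: "holomorphic_family D0 A"
    and selfadj: "\<And>x. x \<in> D0 \<Longrightarrow> selfadjoint_operator (A x)"
    and eigen: "\<And>n. n \<ge> 1 \<Longrightarrow> decreasing_eigenvalues (truncation_matrix e (A 0) n) n (lam n)"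
    and weights: "\<And>n k. n \<ge> 1 \<Longrightarrow> k < n \<Longrightarrow> 0 \<le> w n k \<and> w n k \<le> 1"
    and weights_sum: "\<And>n. n \<ge> 1 \<Longrightarrow> (\<Sum>k<n. w n k) = 1"
    and few: "\<exists>\<delta>>0. \<exists>K::real>0. \<forall>n\<ge>1.
        real (card {j. j < n \<and> \<bar>(\<Sum>k<n. w n k * lam n k) - lam n j\<bar> < \<delta>}) < K"
    and spectra: "essential_spectrum (A 0) = op_spectrum (A 0)"
  shows "\<exists>r>0. ball 0 r \<subseteq> D0 \<and> (\<forall>x\<in>ball 0 r. has_gap (essential_spectrum (A x)))"
proof -
  have A0: "selfadjoint_operator (A 0)"
    using selfadj domain(3) .
  have char_poly: "char_poly (truncation_matrix e (A 0) n) = (\<Prod>k<n. [:- complex_of_real (lam n k), 1:])"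
    and decreasing: "j \<le> k \<Longrightarrow> k < n \<Longrightarrow> lam n k \<le> lam n j" if "1 \<le> n" for n j k
    using eigen[OF that] by (auto simp: decreasing_eigenvalues_def)
  define c where "c n = (\<Sum>k<n. w n k * lam n k)" for n
  obtain \<delta> K where \<delta>: "0 < \<delta>" and few_K: "\<And>n. 1 \<le> n \<Longrightarrow>
      real (card {j. j < n \<and> \<bar>c n - lam n j\<bar> < \<delta>}) < K"
    using few unfolding c_def by blast
  have numerical: "\<exists>v. norm v = 1 \<and> Re (cinner v (A 0 v)) = lam n k" if "1 \<le> n" "k < n" for n k
    using truncation_eigenvalue_numerical_value[OF basis A0 char_poly[OF that(1)] that(2)] by blast
  obtain B where B: "0 < B" "\<And>v. norm (A 0 v) \<le> B * norm v"
    using bounded_operator_bound[OF selfadjoint_bounded[OF A0]] by blast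
  have lam_bound: "\<bar>lam n k\<bar> \<le> B" if n: "1 \<le> n" "k < n" for n k
  proof -
    obtain v where v: "norm v = 1" "Re (cinner v (A 0 v)) = lam n k"
      using numerical[OF n] by blast
    show ?thesis
      using abs_Re_le_cmod[of "cinner v (A 0 v)"] cauchy_schwarz[of v "A 0 v"] B(2)[of v] v by simp
  qed
  have c_bound: "\<bar>c n\<bar> \<le> B" for n
  proof (cases "1 \<le> n")
    case True
    then show ?thesis
      using weighted_mean_bounds[of n "w n" "- B" "lam n" B] weights weights_sum lam_bound
      by (auto simp: c_def abs_le_iff minus_le_iff)
  next
    case False
    then show ?thesis
      using B(1) by (simp add: c_def not_le)
  qed
  then have "bounded (range c)"
    by (auto simp: bounded_iff)
  then obtain c0 r where r: "strict_mono r" "(c \<circ> r) \<longlonglongrightarrow> c0"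
    using bounded_imp_convergent_subsequence by blast
  have close: "\<forall>\<^sub>F m in sequentially. \<bar>c (r m) - c0\<bar> < \<epsilon> \<and> 1 \<le> r m" if "0 < \<epsilon>" for \<epsilon>
  proof (rule eventually_conj)
    show "\<forall>\<^sub>F m in sequentially. \<bar>c (r m) - c0\<bar> < \<epsilon>"
      using tendstoD[OF r(2) that] by (simp add: dist_real_def)
    show "\<forall>\<^sub>F m in sequentially. 1 \<le> r m"
      using eventually_subseq[OF r(1) eventually_ge_at_top] .
  qed
  \<comment> \<open>The \<open>\<epsilon>\<close> here does not depend on \<open>t\<close>; this uniformity lets one perturbation bound serve all \<open>t\<close>.\<close>
  have regular: "\<not> essentially_singular (A 0) (complex_of_real t) (\<delta> / 16)" if t: "\<bar>t - c0\<bar> \<le> \<delta> / 4" for t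
  proof
    assume "essentially_singular (A 0) (complex_of_real t) (\<delta> / 16)"
    then have "\<forall>\<^sub>F n in sequentially.
        real (nat \<lceil>4 * K\<rceil>) \<le> 4 * real (card {j. j < n \<and> \<bar>lam n j - t\<bar> < \<delta> / 4})"
      using essentially_singular_crowding[OF basis A0 char_poly, of "\<delta> / 4" t] \<delta> by simp
    from eventually_conj[OF eventually_subseq[OF r(1) this] close[of "\<delta> / 2"]]
    obtain m where m: "real (nat \<lceil>4 * K\<rceil>) \<le> 4 * real (card {j. j < r m \<and> \<bar>lam (r m) j - t\<bar> < \<delta> / 4})"
      "\<bar>c (r m) - c0\<bar> < \<delta> / 2" "1 \<le> r m"
      using \<delta> eventually_happens'[OF sequentially_bot] by fastforce
    have "\<bar>c (r m) - lam (r m) j\<bar> < \<delta>" if "\<bar>lam (r m) j - t\<bar> < \<delta> / 4" for j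
      using m(2) t that unfolding abs_less_iff abs_le_iff by linarith
    then have "card {j. j < r m \<and> \<bar>lam (r m) j - t\<bar> < \<delta> / 4} \<le> card {j. j < r m \<and> \<bar>c (r m) - lam (r m) j\<bar> < \<delta>}"
      by (intro card_mono) auto
    with few_K[OF m(3)] m(1) show False
      by linarith
  qed
  obtain m where m: "\<bar>c (r m) - c0\<bar> < \<delta> / 4" "1 \<le> r m"
    using eventually_happens'[OF sequentially_bot close[of "\<delta> / 4"]] \<delta> by auto
  have spectral: "essentially_singular (A 0) (complex_of_real t) \<epsilon>"
    if "complex_of_real t \<in> op_spectrum (A 0)" "0 < \<epsilon>" for t \<epsilon>
    using not_in_essential_spectrum[OF A0 that(2)] that(1) spectra by blast
  \<comment> \<open>The mean lies between values of the numerical range, so the spectrum has points on both sides of it.\<close>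
  have "lam (r m) (r m - 1) \<le> c (r m)" "c (r m) \<le> lam (r m) 0"
    using weighted_mean_bounds[of "r m" "w (r m)" "lam (r m) (r m - 1)" "lam (r m)" "lam (r m) 0"]
      m(2) weights weights_sum decreasing by (auto simp: c_def)
  moreover obtain v1 v2 where "norm v1 = 1" "Re (cinner v1 (A 0 v1)) = lam (r m) (r m - 1)"
    "norm v2 = 1" "Re (cinner v2 (A 0 v2)) = lam (r m) 0"
    using numerical[OF m(2), of "r m - 1"] numerical[OF m(2), of 0] m(2) by auto
  ultimately obtain t1 t2 where t: "t1 \<le> c (r m)" "complex_of_real t1 \<in> op_spectrum (A 0)"
    "c (r m) \<le> t2" "complex_of_real t2 \<in> op_spectrum (A 0)"
    using op_spectrum_below_numerical_value[OF A0] op_spectrum_above_numerical_value[OF A0]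
    by (metis order_trans)
  have "\<not> \<bar>t1 - c0\<bar> \<le> \<delta> / 4" "\<not> \<bar>t2 - c0\<bar> \<le> \<delta> / 4"
    using regular spectral t \<delta> by force+
  with m(1) t have t1: "t1 < c0 - \<delta> / 4" and t2: "c0 + \<delta> / 4 < t2"
    by linarith+
  \<comment> \<open>Half of the margin \<open>\<delta> / 16\<close> found above is spent on the perturbation, half is left for \<open>A x\<close>.\<close>
  obtain \<rho> where \<rho>: "0 < \<rho>" "ball 0 \<rho> \<subseteq> D0"
    "\<And>x v. x \<in> ball 0 \<rho> \<Longrightarrow> norm (A x v - A 0 v) \<le> \<delta> / 32 * norm v"
    using holomorphic_family_continuous[OF holo domain(1,3), of "\<delta> / 32"] \<delta> by auto
  have "has_gap (essential_spectrum (A x))" if x: "x \<in> ball 0 \<rho>" for x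
  proof -
    have Ax: "selfadjoint_operator (A x)"
      using selfadj x \<rho>(2) by blast
    have to_Ax: "norm (A 0 v - A x v) \<le> \<delta> / 32 * norm v" for v
      using \<rho>(3)[OF x, of v] by (simp add: norm_minus_commute)
    have "essentially_singular (A x) (complex_of_real t1) (\<delta> / 16)"
      "essentially_singular (A x) (complex_of_real t2) (\<delta> / 16)"
      using essentially_singular_perturb[OF spectral[OF t(2), of "\<delta> / 32"] to_Ax]
        essentially_singular_perturb[OF spectral[OF t(4), of "\<delta> / 32"] to_Ax] \<delta> by simp_all
    then obtain s1 s2 where s: "s1 \<le> t1 + \<delta> / 16" "complex_of_real s1 \<in> essential_spectrum (A x)"
      "t2 - \<delta> / 16 \<le> s2" "complex_of_real s2 \<in> essential_spectrum (A x)"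
      using essential_point_below[OF Ax] essential_point_above[OF Ax] in_essential_spectrum
      by metis
    have "complex_of_real s \<notin> essential_spectrum (A x)" if "\<bar>s - c0\<bar> < \<delta> / 8" for s
    proof (rule not_in_essential_spectrum[OF Ax, of "\<delta> / 32"])
      show "\<not> essentially_singular (A x) (complex_of_real s) (\<delta> / 32)"
        using essentially_singular_perturb[of "A x" "complex_of_real s" "\<delta> / 32" "A 0" "\<delta> / 32"]
          \<rho>(3)[OF x] regular[of s] that \<delta> by auto
    qed (use \<delta> in simp)
    moreover have "s1 \<le> c0 - \<delta> / 8" "c0 + \<delta> / 8 \<le> s2" "0 < \<delta> / 8"
      using s t1 t2 \<delta> by linarith+
    ultimately show ?thesis
      using has_gap_around[OF Ax] s(2,4) by blast
  qed
  with \<rho>(1,2) show ?thesis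
    by blast
qed

end
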